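(* Let $d\ge 1$, let $A=\mathbb{C}\langle x_1,\dots,x_d,x_1^*,\dots,x_d^*\rangle$, let $\mathfrak{n}=A/[A,A]$ be the necklace Lie algebra in $2d$ variables with homogeneous components $\mathfrak{n}_k$, and let $A_{ab}=\mathbb{C}[x_1,\dots,x_d,x_1^*,\dots,x_d^*]$ be the polynomial algebra in $2d$ variables equipped with its canonical symplectic Poisson bracket. Then: (1) $\mathfrak{n}_2$ is a Lie subalgebra of $\mathfrak{n}$ and all homogeneous subspaces $\mathfrak{n}_k$ of $\mathfrak{n}$ are $\mathfrak{n}_2$-modules under the bracket of $\mathfrak{n}$; (2) the map $\varphi:\mathfrak{n}\to A_{ab}$ sending (the class of) a word $w$ to its image in the commutative polynomial algebra $A_{ab}$ is a graded morphism of Lie algebras; (3) there are Lie algebra isomorphisms (a) $\mathfrak{n}_{\le 1}\cong \mathfrak{h}(2d+1)$, (b) $\mathfrak{n}_2\cong\mathfrak{sp}(2d)$, (c) $\mathfrak{n}_{\le 2}\cong \mathfrak{h}(2d+1)\rtimes\mathfrak{sp}(2d)$.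
   Context: All associative algebras are unital over $\mathbb{C}$ and $\otimes=\otimes_{\mathbb{C}}$. The canonical symplectic double bracket on $A$ is the bilinear map $\{\!\{-,-\}\!\}:A\otimes A\to A\otimes A$ determined by $\{\!\{x_i,x_j\}\!\}=\{\!\{x_i^*,x_j^*\}\!\}=0$ for all $i,j$, $\{\!\{x_i,x_j^*\}\!\}=0$ for $i\ne j$, $\{\!\{x_i,x_i^*\}\!\}=1\otimes 1$, together with $\{\!\{a,b\}\!\}=-\{\!\{b,a\}\!\}^{o}$ (where $(u\otimes v)^o=v\otimes u$) and $\{\!\{a,bc\}\!\}=b\{\!\{a,c\}\!\}+\{\!\{a,b\}\!\}c$ for the outer bimodule structure $a(u\otimes v)c=(au)\otimes(vc)$. With $\mu$ the multiplication of $A$, put $\{a,b\}_L=\mu(\{\!\{a,b\}\!\})$. Let $[A,A]$ be the vector space spanned by all commutators; $\{-,-\}_L$ induces a Lie bracket on the vector space quotient $\mathfrak{n}=A/[A,A]$, called the necklace Lie algebra in $2d$ variables. It is graded by word length, $\mathfrak{n}=\bigoplus_{k\ge0}\mathfrak{n}_k$, and the bracket has degree $-2$; $\mathfrak{n}_{\le k}=\bigoplus_{i\le k}\mathfrak{n}_i$. The canonical symplectic Poisson bracket on $A_{ab}$ is given by $\{x_i,x_j\}=\{x_i^*,x_j^*\}=0$, $\{x_i,x_j^*\}=\delta_{ij}$. $\mathfrak{h}(2d+1)$ is the Heisenberg Lie algebra of dimension $2d+1$ and $\mathfrak{sp}(2d)$ the symplectic Lie algebra (of $2d\times 2d$ matrices),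 acting on $\mathfrak{h}(2d+1)$ by its defining representation on the $2d$-dimensional part and trivially on the center. *)

theory Defs
  imports "HOL-Analysis.Analysis" "HOL-Library.Poly_Mapping"
begin

section \<open>Lie algebras carried by subspaces\<close>

locale lie_algebra = vector_space scale
  for scale :: "'k::field \<Rightarrow> 'a::ab_group_add \<Rightarrow> 'a" +
  fixes L :: "'a set" and br :: "'a \<Rightarrow> 'a \<Rightarrow> 'a"
  assumes subspace_carrier: "subspace L"
    and br_closed: "x \<in> L \<Longrightarrow> y \<in> L \<Longrightarrow> br x y \<in> L"
    and br_add_left: "x \<in> L \<Longrightarrow> y \<in> L \<Longrightarrow> z \<in> L \<Longrightarrow> br (x + y) z = br x z + br y z"
    and br_add_right: "x \<in> L \<Longrightarrow> y \<in> L \<Longrightarrow> z \<in> L \<Longrightarrow> br x (y + z) = br x y + br x z"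
    and br_scale_left: "x \<in> L \<Longrightarrow> y \<in> L \<Longrightarrow> br (scale c x) y = scale c (br x y)"
    and br_scale_right: "x \<in> L \<Longrightarrow> y \<in> L \<Longrightarrow> br x (scale c y) = scale c (br x y)"
    and br_self: "x \<in> L \<Longrightarrow> br x x = 0"
    and jacobi: "x \<in> L \<Longrightarrow> y \<in> L \<Longrightarrow> z \<in> L \<Longrightarrow>
      br x (br y z) + br y (br z x) + br z (br x y) = 0"

definition lie_subalgebra ::
  "('k::field \<Rightarrow> 'a::ab_group_add \<Rightarrow> 'a) \<Rightarrow> 'a set \<Rightarrow> ('a \<Rightarrow> 'a \<Rightarrow> 'a) \<Rightarrow> 'a set \<Rightarrow> bool" where
  "lie_subalgebra s L br M \<longleftrightarrow>
     lie_algebra s L br \<and> module.subspace s M \<and> M \<subseteq> L \<and> (\<forall>x\<in>M. \<forall>y\<in>M. br x y \<in> M)"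

definition lie_module ::
  "('k::field \<Rightarrow> 'a::ab_group_add \<Rightarrow> 'a) \<Rightarrow> 'a set \<Rightarrow> ('a \<Rightarrow> 'a \<Rightarrow> 'a) \<Rightarrow>
   ('k \<Rightarrow> 'v::ab_group_add \<Rightarrow> 'v) \<Rightarrow> 'v set \<Rightarrow> ('a \<Rightarrow> 'v \<Rightarrow> 'v) \<Rightarrow> bool" where
  "lie_module s L br t V act \<longleftrightarrow>
     lie_algebra s L br \<and> vector_space t \<and> module.subspace t V \<and>
     (\<forall>x\<in>L. \<forall>v\<in>V. act x v \<in> V) \<and>
     (\<forall>x\<in>L. \<forall>y\<in>L. \<forall>v\<in>V. act (x + y) v = act x v + act y v) \<and>
     (\<forall>x\<in>L. \<forall>v\<in>V. \<forall>w\<in>V. act x (v + w) = act x v + act x w) \<and>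
     (\<forall>c. \<forall>x\<in>L. \<forall>v\<in>V. act (s c x) v = t c (act x v) \<and> act x (t c v) = t c (act x v)) \<and>
     (\<forall>x\<in>L. \<forall>y\<in>L. \<forall>v\<in>V. act (br x y) v = act x (act y v) - act y (act x v))"

definition lie_hom ::
  "('k::field \<Rightarrow> 'a::ab_group_add \<Rightarrow> 'a) \<Rightarrow> 'a set \<Rightarrow> ('a \<Rightarrow> 'a \<Rightarrow> 'a) \<Rightarrow>
   ('k \<Rightarrow> 'b::ab_group_add \<Rightarrow> 'b) \<Rightarrow> 'b set \<Rightarrow> ('b \<Rightarrow> 'b \<Rightarrow> 'b) \<Rightarrow> ('a \<Rightarrow> 'b) \<Rightarrow> bool" where
  "lie_hom s L br t M br' f \<longleftrightarrow>
     lie_algebra s L br \<and> lie_algebra t M br' \<and> f ` L \<subseteq> M \<and>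
     (\<forall>x\<in>L. \<forall>y\<in>L. f (x + y) = f x + f y) \<and>
     (\<forall>c. \<forall>x\<in>L. f (s c x) = t c (f x)) \<and>
     (\<forall>x\<in>L. \<forall>y\<in>L. f (br x y) = br' (f x) (f y))"

definition lie_isomorphic ::
  "('k::field \<Rightarrow> 'a::ab_group_add \<Rightarrow> 'a) \<Rightarrow> 'a set \<Rightarrow> ('a \<Rightarrow> 'a \<Rightarrow> 'a) \<Rightarrow>
   ('k \<Rightarrow> 'b::ab_group_add \<Rightarrow> 'b) \<Rightarrow> 'b set \<Rightarrow> ('b \<Rightarrow> 'b \<Rightarrow> 'b) \<Rightarrow> bool" where
  "lie_isomorphic s L br t M br' \<longleftrightarrow> (\<exists>f. lie_hom s L br t M br' f \<and> bij_betw f L M)"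

definition prod_scale ::
  "('k \<Rightarrow> 'a \<Rightarrow> 'a) \<Rightarrow> ('k \<Rightarrow> 'b \<Rightarrow> 'b) \<Rightarrow> 'k \<Rightarrow> 'a \<times> 'b \<Rightarrow> 'a \<times> 'b" where
  "prod_scale s t c = (\<lambda>(x, y). (s c x, t c y))"

text \<open>Bracket of the semidirect product \<open>L \<rtimes> M\<close>, on pairs, for an action of \<open>M\<close> on the ideal \<open>L\<close>.\<close>

definition semidirect_bracket ::
  "('a::ab_group_add \<Rightarrow> 'a \<Rightarrow> 'a) \<Rightarrow> ('b \<Rightarrow> 'b \<Rightarrow> 'b) \<Rightarrow> ('b \<Rightarrow> 'a \<Rightarrow> 'a) \<Rightarrow> 'a \<times> 'b \<Rightarrow> 'a \<times> 'b \<Rightarrow> 'a \<times> 'b" where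
  "semidirect_bracket brL brM act =
     (\<lambda>(h, m) (h', m'). (brL h h' + act m h' - act m' h, brM m m'))"


section \<open>Symplectic and Heisenberg Lie algebras\<close>

text \<open>The index type \<open>'d + 'd\<close>, with \<open>d = CARD('d) \<ge> 1\<close>, labels the \<open>2d\<close> variables:
  \<open>Inl i\<close> stands for \<open>x\<^sub>i\<close> and \<open>Inr i\<close> for \<open>x\<^sub>i\<^sup>*\<close>.\<close>

fun sform :: "'d + 'd \<Rightarrow> 'd + 'd \<Rightarrow> complex" where
  "sform (Inl i) (Inr j) = (if i = j then 1 else 0)"
| "sform (Inr i) (Inl j) = (if i = j then -1 else 0)"
| "sform (Inl i) (Inl j) = 0"
| "sform (Inr i) (Inr j) = 0"

definition sform_matrix :: "complex ^ ('d::finite + 'd) ^ ('d + 'd)" where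
  "sform_matrix = (\<chi> a b. sform a b)"

definition mat_scale :: "complex \<Rightarrow> complex ^ 'n ^ 'm \<Rightarrow> complex ^ 'n ^ 'm" where
  "mat_scale c M = (\<chi> a b. c * M $ a $ b)"

definition mat_bracket :: "complex ^ 'n ^ 'n \<Rightarrow> complex ^ 'n ^ 'n \<Rightarrow> complex ^ 'n::finite ^ 'n" where
  "mat_bracket M N = M ** N - N ** M"

definition sp :: "(complex ^ ('d::finite + 'd) ^ ('d + 'd)) set" where
  "sp = {M. transpose M ** sform_matrix + sform_matrix ** M = 0}"

type_synonym 'd heis = "(complex ^ ('d + 'd)) \<times> complex"

definition heis_bracket :: "'d::finite heis \<Rightarrow> 'd heis \<Rightarrow> 'd heis" where
  "heis_bracket = (\<lambda>(v, s) (w, t).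
     (0, \<Sum>i\<in>UNIV. v $ Inl i * w $ Inr i - v $ Inr i * w $ Inl i))"

definition heis_scale :: "complex \<Rightarrow> 'd::finite heis \<Rightarrow> 'd heis" where
  "heis_scale = prod_scale (*s) (*)"

definition heis_act :: "complex ^ ('d::finite + 'd) ^ ('d + 'd) \<Rightarrow> 'd heis \<Rightarrow> 'd heis" where
  "heis_act M = (\<lambda>(v, s). (M *v v, 0))"


section \<open>Linear maps between free vector spaces\<close>

definition pm_scale :: "complex \<Rightarrow> ('a \<Rightarrow>\<^sub>0 complex) \<Rightarrow> ('a \<Rightarrow>\<^sub>0 complex)" where
  "pm_scale c p = Poly_Mapping.map ((*) c) p"

abbreviation pm_linear :: "(('a \<Rightarrow>\<^sub>0 complex) \<Rightarrow> ('b \<Rightarrow>\<^sub>0 complex)) \<Rightarrow> bool" where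
  "pm_linear \<equiv> Vector_Spaces.linear pm_scale pm_scale"

definition lin_ext :: "('a \<Rightarrow> ('b \<Rightarrow>\<^sub>0 complex)) \<Rightarrow> ('a \<Rightarrow>\<^sub>0 complex) \<Rightarrow> ('b \<Rightarrow>\<^sub>0 complex)" where
  "lin_ext f p = (\<Sum>a\<in>Poly_Mapping.keys p. pm_scale (Poly_Mapping.lookup p a) (f a))"

definition bilin_ext :: "('a \<Rightarrow> 'b \<Rightarrow> ('c \<Rightarrow>\<^sub>0 complex)) \<Rightarrow>
    ('a \<Rightarrow>\<^sub>0 complex) \<Rightarrow> ('b \<Rightarrow>\<^sub>0 complex) \<Rightarrow> ('c \<Rightarrow>\<^sub>0 complex)" where
  "bilin_ext f p q = lin_ext (\<lambda>a. lin_ext (f a) q) p"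

abbreviation basis :: "'a \<Rightarrow> ('a \<Rightarrow>\<^sub>0 complex)" where
  "basis a \<equiv> Poly_Mapping.single a 1"

lemma lookup_pm_scale [simp]: "Poly_Mapping.lookup (pm_scale c p) a = c * Poly_Mapping.lookup p a"
  by (simp add: pm_scale_def Poly_Mapping.map.rep_eq when_def)

lemma vector_space_pm: "vector_space pm_scale"
  by unfold_locales (auto intro!: poly_mapping_eqI simp: lookup_add algebra_simps)

interpretation pm: vector_space pm_scale
  by (rule vector_space_pm)

lemma pm_linearI:
  assumes "\<And>p q. f (p + q) = f p + f q" and "\<And>c p. f (pm_scale c p) = pm_scale c (f p)"
  shows "pm_linear f"
  using assms by (simp add: Vector_Spaces.linear_iff vector_space_pm)

lemma pm_linearD:
  assumes "pm_linear f"
  shows pm_linear_add: "f (p + q) = f p + f q" and pm_linear_scale: "f (pm_scale c p) = pm_scale c (f p)"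
    and pm_linear_zero: "f 0 = 0" and pm_linear_minus: "f (- p) = - f p" and pm_linear_diff: "f (p - q) = f p - f q"
proof -
  interpret Vector_Spaces.linear pm_scale pm_scale f by fact
  show "f (p + q) = f p + f q" "f (pm_scale c p) = pm_scale c (f p)" "f 0 = 0" "f (- p) = - f p"
    "f (p - q) = f p - f q"
    by (rule add scale zero neg diff)+
qed

lemma pm_linear_sum: "pm_linear f \<Longrightarrow> f (sum g A) = (\<Sum>a\<in>A. f (g a))"
  by (induction A rule: infinite_finite_induct) (auto simp: pm_linear_zero pm_linear_add)

lemma pm_expand: "p = (\<Sum>a\<in>Poly_Mapping.keys p. pm_scale (Poly_Mapping.lookup p a) (basis a))"
proof (rule poly_mapping_eqI)
  fix k
  have "(\<Sum>a\<in>Poly_Mapping.keys p. Poly_Mapping.lookup p a * (1 when a = k)) =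
      (\<Sum>a\<in>Poly_Mapping.keys p. if a = k then Poly_Mapping.lookup p a else 0)"
    by (rule sum.cong) auto
  also have "\<dots> = Poly_Mapping.lookup p k"
    by (simp add: in_keys_iff)
  finally show "Poly_Mapping.lookup p k = Poly_Mapping.lookup
      (\<Sum>a\<in>Poly_Mapping.keys p. pm_scale (Poly_Mapping.lookup p a) (basis a)) k"
    by (simp add: lookup_sum lookup_single)
qed

lemma pm_linear_in_subspace:
  assumes "pm_linear f" "pm.subspace S" "\<And>a. f (basis a) \<in> S"
  shows "f p \<in> S"
proof -
  have "f p = (\<Sum>a\<in>Poly_Mapping.keys p. pm_scale (Poly_Mapping.lookup p a) (f (basis a)))"
    by (subst pm_expand) (simp add: pm_linear_sum[OF assms(1)] pm_linear_scale[OF assms(1)])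
  then show ?thesis
    by (simp add: pm.subspace_sum[OF assms(2)] pm.subspace_scale[OF assms(2)] assms(3))
qed

lemma pm_linear_eqI:
  assumes "pm_linear f" "pm_linear g" "\<And>a. f (basis a) = g (basis a)"
  shows "f p = g p"
proof -
  have "f p = (\<Sum>a\<in>Poly_Mapping.keys p. pm_scale (Poly_Mapping.lookup p a) (f (basis a)))"
    by (subst pm_expand) (simp add: pm_linear_sum[OF assms(1)] pm_linear_scale[OF assms(1)])
  moreover have "g p = (\<Sum>a\<in>Poly_Mapping.keys p. pm_scale (Poly_Mapping.lookup p a) (g (basis a)))"
    by (subst pm_expand) (simp add: pm_linear_sum[OF assms(2)] pm_linear_scale[OF assms(2)])
  ultimately show ?thesis by (simp add: assms(3))
qed

lemma pm_bilinear_eqI: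
  assumes "\<And>q. pm_linear (\<lambda>p. f p q)" "\<And>p. pm_linear (f p)"
    "\<And>q. pm_linear (\<lambda>p. g p q)" "\<And>p. pm_linear (g p)"
    and "\<And>a b. f (basis a) (basis b) = g (basis a) (basis b)"
  shows "f p q = g p q"
proof (rule pm_linear_eqI[where f = "\<lambda>p. f p q" and g = "\<lambda>p. g p q", OF assms(1) assms(3)])
  show "f (basis a) q = g (basis a) q" for a
    by (rule pm_linear_eqI[OF assms(2) assms(4) assms(5)])
qed

lemma pm_trilinear_eqI:
  assumes "\<And>q r. pm_linear (\<lambda>p. f p q r)" "\<And>p r. pm_linear (\<lambda>q. f p q r)" "\<And>p q. pm_linear (f p q)"
    "\<And>q r. pm_linear (\<lambda>p. g p q r)" "\<And>p r. pm_linear (\<lambda>q. g p q r)" "\<And>p q. pm_linear (g p q)"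
    and "\<And>a b c. f (basis a) (basis b) (basis c) = g (basis a) (basis b) (basis c)"
  shows "f p q r = g p q r"
proof (rule pm_linear_eqI[where f = "\<lambda>p. f p q r" and g = "\<lambda>p. g p q r", OF assms(1) assms(4)])
  show "f (basis a) q r = g (basis a) q r" for a
    by (rule pm_bilinear_eqI[OF assms(2) assms(3) assms(5) assms(6) assms(7)])
qed

lemma lin_ext_superset:
  assumes "finite A" "Poly_Mapping.keys p \<subseteq> A"
  shows "lin_ext f p = (\<Sum>a\<in>A. pm_scale (Poly_Mapping.lookup p a) (f a))"
  unfolding lin_ext_def by (rule sum.mono_neutral_left) (use assms in \<open>auto simp: in_keys_iff\<close>)

lemma linear_lin_ext: "pm_linear (lin_ext f)"
proof (rule pm_linearI)
  fix p q :: "'a \<Rightarrow>\<^sub>0 complex" and c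
  let ?A = "Poly_Mapping.keys p \<union> Poly_Mapping.keys q"
  have "Poly_Mapping.keys (p + q) \<subseteq> ?A" by (rule Poly_Mapping.keys_add)
  then show "lin_ext f (p + q) = lin_ext f p + lin_ext f q"
    by (simp add: lin_ext_superset[where A = ?A] lookup_add pm.scale_left_distrib sum.distrib)
  have "Poly_Mapping.keys (pm_scale c p) \<subseteq> Poly_Mapping.keys p" by (auto simp: in_keys_iff)
  then show "lin_ext f (pm_scale c p) = pm_scale c (lin_ext f p)"
    by (simp add: lin_ext_superset[where A = "Poly_Mapping.keys p"] pm.scale_sum_right)
qed

lemma lin_ext_basis [simp]: "lin_ext f (basis a) = f a"
  by (simp add: lin_ext_def)

lemma bilin_ext_basis [simp]: "bilin_ext f (basis a) (basis b) = f a b"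
  by (simp add: bilin_ext_def)

lemma linear_bilin_ext_left: "pm_linear (\<lambda>p. bilin_ext f p q)"
  by (simp add: bilin_ext_def linear_lin_ext)

lemma linear_bilin_ext_right: "pm_linear (bilin_ext f p)"
proof -
  have l: "lin_ext (f a) (x + y) = lin_ext (f a) x + lin_ext (f a) y"
    "lin_ext (f a) (pm_scale c x) = pm_scale c (lin_ext (f a) x)" for a x y c
    by (rule pm_linear_add[OF linear_lin_ext] pm_linear_scale[OF linear_lin_ext])+
  show ?thesis
    by (rule pm_linearI)
      (simp_all add: bilin_ext_def l, simp_all add: lin_ext_def[where p = p] sum.distrib
        pm.scale_right_distrib pm.scale_sum_right mult.commute)
qed

lemma pm_linear_comp: "pm_linear f \<Longrightarrow> pm_linear g \<Longrightarrow> pm_linear (\<lambda>x. f (g x))"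
  by (rule pm_linearI) (simp_all add: pm_linear_add pm_linear_scale)

lemma pm_linear_sub: "pm_linear f \<Longrightarrow> pm_linear g \<Longrightarrow> pm_linear (\<lambda>x. f x - g x)"
  by (rule pm_linearI) (simp_all add: pm_linear_add pm_linear_scale pm.scale_right_diff_distrib)

lemma pm_linear_plus: "pm_linear f \<Longrightarrow> pm_linear g \<Longrightarrow> pm_linear (\<lambda>x. f x + g x)"
  by (rule pm_linearI) (simp_all add: pm_linear_add pm_linear_scale pm.scale_right_distrib)

lemma pm_linear_neg: "pm_linear f \<Longrightarrow> pm_linear (\<lambda>x. - f x)"
  by (rule pm_linearI) (simp_all add: pm_linear_add pm_linear_scale)

lemma pm_linear_0: "pm_linear (\<lambda>x. 0)"
  by (rule pm_linearI) simp_all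

lemma pm_linear_id: "pm_linear (\<lambda>x. x)"
  by (rule pm_linearI) simp_all

lemma pm_linear_bigsum: "(\<And>i. i \<in> I \<Longrightarrow> pm_linear (f i)) \<Longrightarrow> pm_linear (\<lambda>x. \<Sum>i\<in>I. f i x)"
  by (induction I rule: infinite_finite_induct) (auto intro: pm_linear_plus pm_linear_0)

lemma pm_scale_conv_mult: "pm_scale c p = Poly_Mapping.single 0 c * p"
  for p :: "'a::monoid_add \<Rightarrow>\<^sub>0 complex"
  by (simp add: pm_scale_def mult_map_scale_conv_mult)

lemma pm_scale_mult_left: "pm_scale c p * q = pm_scale c (p * q)"
  for p q :: "'a::monoid_add \<Rightarrow>\<^sub>0 complex"
  by (simp add: pm_scale_conv_mult mult.assoc)

lemma single_0_commute: "p * Poly_Mapping.single 0 c = Poly_Mapping.single 0 c * p"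
  for p :: "'a::monoid_add \<Rightarrow>\<^sub>0 complex"
proof -
  have "p * Poly_Mapping.single 0 c = pm_scale c p"
  proof (rule pm_linear_eqI[where f = "\<lambda>p. p * Poly_Mapping.single 0 c"])
    show "pm_linear (\<lambda>p::'a \<Rightarrow>\<^sub>0 complex. p * Poly_Mapping.single 0 c)"
      by (rule pm_linearI) (simp_all add: distrib_right pm_scale_mult_left)
    show "pm_linear (pm_scale c)"
      by (rule pm_linearI) (simp_all add: pm.scale_right_distrib mult.commute)
    show "basis a * Poly_Mapping.single 0 c = pm_scale c (basis a)" for a :: 'a
      by (simp add: mult_single pm_scale_conv_mult)
  qed
  then show ?thesis by (simp add: pm_scale_conv_mult)
qed

lemma pm_scale_mult_right: "p * pm_scale c q = pm_scale c (p * q)"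
  for p q :: "'a::monoid_add \<Rightarrow>\<^sub>0 complex"
  by (simp add: pm_scale_conv_mult mult.assoc[symmetric] single_0_commute)

lemma pm_linear_mult_left: "pm_linear f \<Longrightarrow> pm_linear (\<lambda>x. f x * q)"
  for q :: "'a::monoid_add \<Rightarrow>\<^sub>0 complex"
  by (rule pm_linearI) (simp_all add: pm_linear_add pm_linear_scale distrib_right pm_scale_mult_left)

lemma pm_linear_mult_right: "pm_linear f \<Longrightarrow> pm_linear (\<lambda>x. q * f x)"
  for q :: "'a::monoid_add \<Rightarrow>\<^sub>0 complex"
  by (rule pm_linearI) (simp_all add: pm_linear_add pm_linear_scale distrib_left pm_scale_mult_right)


section \<open>The free algebra and its tensor square\<close>

text \<open>Words under concatenation form a monoid, so the convolution product of
  \<^theory>\<open>HOL-Library.Poly_Mapping\<close> makes \<open>('d + 'd) list \<Rightarrow>\<^sub>0 complex\<close> the free associative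
  algebra \<open>A\<close>. Likewise \<open>A \<otimes> A\<close> is the monoid algebra of the product monoid.\<close>

instantiation list :: (type) monoid_add
begin

definition zero_list :: "'a list" where "zero_list = []"
definition plus_list :: "'a list \<Rightarrow> 'a list \<Rightarrow> 'a list" where "plus_list = (@)"

instance by standard (simp_all add: zero_list_def plus_list_def)

end

type_synonym 'd falg = "('d + 'd) list \<Rightarrow>\<^sub>0 complex"
type_synonym 'd falg2 = "(('d + 'd) list \<times> ('d + 'd) list) \<Rightarrow>\<^sub>0 complex"

definition fgen :: "'d + 'd \<Rightarrow> 'd falg" where
  "fgen g = basis [g]"

definition tensor :: "'d falg \<Rightarrow> 'd falg \<Rightarrow> 'd falg2" where
  "tensor = bilin_ext (\<lambda>u v. basis (u, v))"

definition tensor_flip :: "'d falg2 \<Rightarrow> 'd falg2" where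
  "tensor_flip = lin_ext (\<lambda>(u, v). basis (v, u))"

definition tensor_mult :: "'d falg2 \<Rightarrow> 'd falg" where
  "tensor_mult = lin_ext (\<lambda>(u, v). basis (u @ v))"

definition outer :: "'d falg \<Rightarrow> 'd falg2 \<Rightarrow> 'd falg \<Rightarrow> 'd falg2" where
  "outer a t c = tensor a 1 * t * tensor 1 c"

lemma one_falg: "(1 :: 'd falg) = basis []"
  by (simp flip: single_one add: zero_list_def)

lemma linear_tensor: "pm_linear (\<lambda>a. tensor a b)" "pm_linear (tensor a)"
  by (simp_all add: tensor_def linear_bilin_ext_left linear_bilin_ext_right)

lemma linear_flip: "pm_linear tensor_flip"
  by (simp add: tensor_flip_def linear_lin_ext)

lemma linear_tmult: "pm_linear tensor_mult"
  by (simp add: tensor_mult_def linear_lin_ext)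

lemma tensor_basis [simp]: "tensor (basis u) (basis v) = basis (u, v)"
  by (simp add: tensor_def)

lemma tensor_mult_tensor: "tensor a b * tensor c d = tensor (a * c) (b * d)"
proof -
  have 1: "tensor a (basis v) * tensor c (basis w) = tensor (a * c) (basis v * basis w)" for v w
    by (rule pm_bilinear_eqI[where f = "\<lambda>a c. tensor a (basis v) * tensor c (basis w)"])
      (auto intro!: pm_linear_mult_left pm_linear_mult_right linear_tensor
        pm_linear_comp[OF linear_tensor(1)] pm_linear_id simp: mult_single)
  show ?thesis
    by (rule pm_bilinear_eqI[where f = "\<lambda>b d. tensor a b * tensor c d"])
      (auto intro!: pm_linear_mult_left pm_linear_mult_right linear_tensor
        pm_linear_comp[OF linear_tensor(2)] pm_linear_id simp: 1)
qed

lemma outer_tensor: "outer a (tensor u v) c = tensor (a * u) (v * c)"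
  by (simp add: outer_def tensor_mult_tensor)

lemma flip_basis [simp]: "tensor_flip (basis (u, v)) = basis (v, u)"
  by (simp add: tensor_flip_def)

lemma tensor_mult_basis [simp]: "tensor_mult (basis (u, v)) = basis (u @ v)"
  by (simp add: tensor_mult_def)

lemma flip_tensor: "tensor_flip (tensor u v) = tensor v u"
  by (rule pm_bilinear_eqI[where f = "\<lambda>u v. tensor_flip (tensor u v)"])
    (auto intro!: pm_linear_comp[OF linear_flip] linear_tensor)

lemma tensor_mult: "tensor_mult (tensor u v) = u * v"
  by (rule pm_bilinear_eqI[where f = "\<lambda>u v. tensor_mult (tensor u v)"])
    (auto intro!: pm_linear_comp[OF linear_tmult] linear_tensor pm_linear_mult_left pm_linear_mult_right
      pm_linear_id simp: mult_single plus_list_def)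

lemma tensor_induct:
  assumes "pm_linear f" "pm_linear g" "\<And>u v. f (tensor u v) = g (tensor u v)"
  shows "f t = g t"
proof (rule pm_linear_eqI[OF assms(1,2)])
  show "f (basis p) = g (basis p)" for p
    using assms(3)[of "basis (fst p)" "basis (snd p)"] by simp
qed

lemma flip_flip: "tensor_flip (tensor_flip t) = t"
  by (rule tensor_induct[where f = "\<lambda>t. tensor_flip (tensor_flip t)" and g = "\<lambda>t. t"])
    (simp_all add: flip_tensor pm_linear_comp[OF linear_flip linear_flip] pm_linear_id)

lemma linear_outer: "pm_linear (\<lambda>t. outer a t c)" "pm_linear (\<lambda>a. outer a t c)" "pm_linear (outer a t)"
  unfolding outer_def
  by (intro pm_linear_mult_left pm_linear_mult_right linear_tensor pm_linear_id)+

lemma outer_1_1 [simp]: "outer 1 t 1 = t"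
proof -
  have "tensor 1 1 = (1 :: 'a falg2)"
    unfolding one_falg tensor_basis by (simp flip: single_one add: zero_list_def zero_prod_def)
  then show ?thesis by (simp add: outer_def)
qed


section \<open>The canonical symplectic double bracket\<close>

definition is_symplectic_double_bracket :: "('d falg \<Rightarrow> 'd falg \<Rightarrow> 'd falg2) \<Rightarrow> bool" where
  "is_symplectic_double_bracket D \<longleftrightarrow>
     (\<forall>b. pm_linear (\<lambda>a. D a b)) \<and> (\<forall>a. pm_linear (D a)) \<and>
     (\<forall>i j. D (fgen (Inl i)) (fgen (Inl j)) = 0) \<and>
     (\<forall>i j. D (fgen (Inr i)) (fgen (Inr j)) = 0) \<and>
     (\<forall>i j. D (fgen (Inl i)) (fgen (Inr j)) = (if i = j then tensor 1 1 else 0)) \<and>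
     (\<forall>a b. D a b = - tensor_flip (D b a)) \<and>
     (\<forall>a b c. D a (b * c) = outer b (D a c) 1 + outer 1 (D a b) c)"

definition double_bracket :: "'d falg \<Rightarrow> 'd falg \<Rightarrow> 'd falg2" where
  "double_bracket = (THE D. is_symplectic_double_bracket D)"

text \<open>Existence and uniqueness, via an explicit formula on words.\<close>

definition word_bracket :: "('d + 'd) list \<Rightarrow> ('d + 'd) list \<Rightarrow> 'd falg2" where
  "word_bracket u v = (\<Sum>i<length u. \<Sum>j<length v. pm_scale (sform (u ! i) (v ! j))
     (basis (take j v @ drop (Suc i) u, take i u @ drop (Suc j) v)))"

lemma sform_antisym: "sform a b = - sform b a"
  by (cases a; cases b) auto

lemma sum_lessThan_add: "(\<Sum>j<m + n. f j) = (\<Sum>j<m. f j) + (\<Sum>j<n. f (m + j))"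
  for f :: "nat \<Rightarrow> 'a::ab_group_add"
  by (induction n) (auto simp: algebra_simps)

lemma word_bracket_antisym: "word_bracket u v = - tensor_flip (word_bracket v u)"
proof -
  have "tensor_flip (word_bracket v u) = (\<Sum>i<length v. \<Sum>j<length u. - pm_scale (sform (u ! j) (v ! i))
     (basis (take i v @ drop (Suc j) u, take j u @ drop (Suc i) v)))"
    unfolding word_bracket_def
    by (simp add: pm_linear_sum[OF linear_flip] pm_linear_scale[OF linear_flip] pm_linear_minus[OF linear_flip] sform_antisym[of "v ! _"])
  also have "\<dots> = - word_bracket u v"
    unfolding word_bracket_def by (subst sum.swap) (simp add: sum_negf)
  finally show ?thesis by simp
qed

lemma outer_basis: "outer (basis a) (basis (u, v)) (basis c) = basis (a @ u, v @ c)"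
  unfolding tensor_basis[symmetric] outer_tensor by (simp add: mult_single plus_list_def)

lemma word_bracket_append:
  "word_bracket u (v @ w) = outer (basis v) (word_bracket u w) 1 + outer 1 (word_bracket u v) (basis w)"
  unfolding word_bracket_def length_append sum_lessThan_add sum.distrib one_falg
  by (simp add: pm_linear_sum[OF linear_outer(1)] pm_linear_scale[OF linear_outer(1)] outer_basis
      nth_append add.commute)

lemma symplectic_double_bracket_exists:
  "is_symplectic_double_bracket (bilin_ext word_bracket :: 'd falg \<Rightarrow> 'd falg \<Rightarrow> 'd falg2)"
  (is "is_symplectic_double_bracket ?D")
proof -
  note lin = linear_bilin_ext_left[of word_bracket] linear_bilin_ext_right[of word_bracket]
  have anti: "?D a b = - tensor_flip (?D b a)" for a b
  proof (rule pm_bilinear_eqI[where f = ?D and g = "\<lambda>a b. - tensor_flip (?D b a)", OF lin])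
    show "pm_linear (\<lambda>p. - tensor_flip (?D q p))" "pm_linear (\<lambda>p. - tensor_flip (?D p q))" for q
      by (rule pm_linear_neg pm_linear_comp[OF linear_flip] lin)+
    show "?D (basis u) (basis v) = - tensor_flip (?D (basis v) (basis u))" for u v :: "('d + 'd) list"
      by (simp only: bilin_ext_basis word_bracket_antisym[of u v])
  qed
  have leib: "?D a (b * c) = outer b (?D a c) 1 + outer 1 (?D a b) c" for a b c
  proof (rule pm_trilinear_eqI[where f = "\<lambda>a b c. ?D a (b * c)"
        and g = "\<lambda>a b c. outer b (?D a c) 1 + outer 1 (?D a b) c"])
    fix p q :: "'d falg"
    show "pm_linear (\<lambda>a. ?D a (p * q))" by (rule lin(1))
    show "pm_linear (\<lambda>b. ?D p (b * q))"
      by (rule pm_linear_comp[OF lin(2) pm_linear_mult_left[OF pm_linear_id]])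
    show "pm_linear (\<lambda>c. ?D p (q * c))"
      by (rule pm_linear_comp[OF lin(2) pm_linear_mult_right[OF pm_linear_id]])
    show "pm_linear (\<lambda>a. outer p (?D a q) 1 + outer 1 (?D a p) q)"
      by (rule pm_linear_plus[OF pm_linear_comp[OF linear_outer(1) lin(1)] pm_linear_comp[OF linear_outer(1) lin(1)]])
    show "pm_linear (\<lambda>b. outer b (?D p q) 1 + outer 1 (?D p b) q)"
      by (rule pm_linear_plus[OF linear_outer(2) pm_linear_comp[OF linear_outer(1) lin(2)]])
    show "pm_linear (\<lambda>c. outer q (?D p c) 1 + outer 1 (?D p q) c)"
      by (rule pm_linear_plus[OF pm_linear_comp[OF linear_outer(1) lin(2)] linear_outer(3)])
  next
    fix u v w :: "('d + 'd) list"
    have "basis v * basis w = basis (v @ w)" by (simp add: mult_single plus_list_def)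
    then show "?D (basis u) (basis v * basis w) =
        outer (basis v) (?D (basis u) (basis w)) 1 + outer 1 (?D (basis u) (basis v)) (basis w)"
      by (simp only: bilin_ext_basis word_bracket_append)
  qed
  have gen: "?D (fgen g) (fgen h) = pm_scale (sform g h) (tensor 1 1)" for g h
    by (simp add: fgen_def word_bracket_def one_falg)
  show ?thesis
    unfolding is_symplectic_double_bracket_def gen
    by (intro conjI allI lin anti leib) simp_all
qed

lemma symplectic_double_bracket_unique:
  assumes "is_symplectic_double_bracket D" "is_symplectic_double_bracket E"
  shows "D = E"
proof -
  have gens: "D (fgen g) (fgen h) = pm_scale (sform g h) (tensor 1 1)"
    if "is_symplectic_double_bracket D" for D :: "'a falg \<Rightarrow> 'a falg \<Rightarrow> 'a falg2" and g h
  proof -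
    have x: "D (fgen (Inl i)) (fgen (Inl j)) = 0" "D (fgen (Inr i)) (fgen (Inr j)) = 0"
      "D (fgen (Inl i)) (fgen (Inr j)) = (if i = j then tensor 1 1 else 0)" for i j
      using that unfolding is_symplectic_double_bracket_def by blast+
    have a: "D (fgen g) (fgen h) = - tensor_flip (D (fgen h) (fgen g))"
      using that unfolding is_symplectic_double_bracket_def by blast
    show ?thesis
    proof (cases g; cases h)
      fix i j assume gh: "g = Inr i" "h = Inl j"
      show ?thesis
        unfolding a unfolding gh x(3)
        by (auto simp: flip_tensor pm_linear_zero[OF linear_flip])
    qed (simp_all add: x)
  qed
  have one: "D a 1 = 0" if "is_symplectic_double_bracket D"
    for D :: "'a falg \<Rightarrow> 'a falg \<Rightarrow> 'a falg2" and a
  proof -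
    have "D a (1 * 1) = outer 1 (D a 1) 1 + outer 1 (D a 1) 1"
      using that unfolding is_symplectic_double_bracket_def by blast
    then show ?thesis by simp
  qed
  have leib: "D a (b * c) = outer b (D a c) 1 + outer 1 (D a b) c"
    if "is_symplectic_double_bracket D" for D :: "'a falg \<Rightarrow> 'a falg \<Rightarrow> 'a falg2" and a b c
    using that unfolding is_symplectic_double_bracket_def by blast
  have Cons: "basis (g # w) = fgen g * basis w" for g :: "'a + 'a" and w
    by (simp add: fgen_def mult_single plus_list_def)
  have ext: "D a (basis w) = E a (basis w)"
    if "\<And>g. D a (fgen g) = E a (fgen g)" for a w
    by (induction w) (simp_all add: Cons leib[OF assms(1)] leib[OF assms(2)] that
        one[OF assms(1)] one[OF assms(2)] flip: one_falg)
  have anti: "D a b = - tensor_flip (D b a)" "E a b = - tensor_flip (E b a)" for a b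
    using assms unfolding is_symplectic_double_bracket_def by blast+
  have "D (fgen g) (basis w) = E (fgen g) (basis w)" for g w
    by (rule ext) (simp add: gens assms)
  then have "D (basis w) (fgen g) = E (basis w) (fgen g)" for g w
    by (metis anti)
  then have eq: "D (basis u) (basis w) = E (basis u) (basis w)" for u w
    by (rule ext)
  have lin: "pm_linear (\<lambda>a. D a b)" "pm_linear (D a)" "pm_linear (\<lambda>a. E a b)" "pm_linear (E a)" for a b
    using assms unfolding is_symplectic_double_bracket_def by - (elim conjE, erule spec)+
  have "D a b = E a b" for a b
    by (rule pm_bilinear_eqI[where f = D and g = E, OF lin eq])
  then show ?thesis by blast
qed

lemma double_bracket_symplectic: "is_symplectic_double_bracket double_bracket"
  unfolding double_bracket_def
  by (rule theI[where P = is_symplectic_double_bracket, OF symplectic_double_bracket_exists])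
    (rule symplectic_double_bracket_unique[OF _ symplectic_double_bracket_exists])

lemma double_bracket_eq: "double_bracket = bilin_ext word_bracket"
  by (rule symplectic_double_bracket_unique[OF double_bracket_symplectic symplectic_double_bracket_exists])

definition loday_bracket :: "'d falg \<Rightarrow> 'd falg \<Rightarrow> 'd falg" where
  "loday_bracket a b = tensor_mult (double_bracket a b)"


section \<open>The necklace Lie algebra\<close>

definition commutator_space :: "'d falg set" where
  "commutator_space = module.span pm_scale {a * b - b * a | a b. True}"

lemma subspace_commutator: "pm.subspace commutator_space"
  unfolding commutator_space_def by (rule pm.subspace_span)

lemma commutator_in: "a * b - b * a \<in> commutator_space"
  unfolding commutator_space_def by (rule pm.span_base) blast

lemma commutator_induct:
  assumes "x \<in> commutator_space" "pm_linear f" "pm.subspace S" "\<And>a b. f (a * b - b * a) \<in> S"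
  shows "f x \<in> S"
  using assms(1) unfolding commutator_space_def
proof (induction rule: pm.span_induct)
  case base
  show ?case
    using assms(3) unfolding pm.subspace_def
    by (auto simp: pm_linear_zero[OF assms(2)] pm_linear_add[OF assms(2)] pm_linear_scale[OF assms(2)])
qed (use assms(4) in auto)

lemma commutator_add: "x \<in> commutator_space \<Longrightarrow> y \<in> commutator_space \<Longrightarrow> x + y \<in> commutator_space"
  by (rule pm.subspace_add[OF subspace_commutator])

lemma commutator_neg: "x \<in> commutator_space \<Longrightarrow> - x \<in> commutator_space"
  by (rule pm.subspace_neg[OF subspace_commutator])

lemma commutator_0: "0 \<in> commutator_space"
  by (rule pm.subspace_0[OF subspace_commutator])

quotient_type 'd necklace = "'d falg" / "\<lambda>a b. a - b \<in> commutator_space"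
proof (rule equivpI)
  show "reflp (\<lambda>a b. a - b \<in> (commutator_space :: 'd falg set))"
    by (rule reflpI) (simp add: commutator_0)
  show "symp (\<lambda>a b. a - b \<in> (commutator_space :: 'd falg set))"
  proof (rule sympI)
    fix a b :: "'d falg"
    assume "a - b \<in> commutator_space"
    then have "- (a - b) \<in> commutator_space" by (rule commutator_neg)
    then show "b - a \<in> commutator_space" by simp
  qed
  show "transp (\<lambda>a b. a - b \<in> (commutator_space :: 'd falg set))"
  proof (rule transpI)
    fix a b c :: "'d falg"
    assume "a - b \<in> commutator_space" "b - c \<in> commutator_space"
    then have "(a - b) + (b - c) \<in> commutator_space" by (rule commutator_add)
    then show "a - c \<in> commutator_space" by simp
  qed
qed

instantiation necklace :: (type) ab_group_add
begin

lift_definition zero_necklace :: "'a necklace" is 0 .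

lift_definition plus_necklace :: "'a necklace \<Rightarrow> 'a necklace \<Rightarrow> 'a necklace" is "(+)"
proof -
  fix a b c d :: "'a falg"
  assume "a - b \<in> commutator_space" "c - d \<in> commutator_space"
  then have "(a - b) + (c - d) \<in> commutator_space" by (rule commutator_add)
  then show "a + c - (b + d) \<in> commutator_space" by (simp add: algebra_simps)
qed

lift_definition uminus_necklace :: "'a necklace \<Rightarrow> 'a necklace" is uminus
proof -
  fix a b :: "'a falg"
  assume "a - b \<in> commutator_space"
  then have "- (a - b) \<in> commutator_space" by (rule commutator_neg)
  then show "- a - - b \<in> commutator_space" by (simp add: algebra_simps)
qed

lift_definition minus_necklace :: "'a necklace \<Rightarrow> 'a necklace \<Rightarrow> 'a necklace" is "(-)"
proof -
  fix a b c d :: "'a falg"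
  assume "a - b \<in> commutator_space" "c - d \<in> commutator_space"
  then have "(a - b) - (c - d) \<in> commutator_space" by (rule pm.subspace_diff[OF subspace_commutator])
  then show "a - c - (b - d) \<in> commutator_space" by (simp add: algebra_simps)
qed

instance
proof
  fix a b c :: "'a necklace"
  show "a + b + c = a + (b + c)" by transfer (simp add: algebra_simps commutator_0)
  show "a + b = b + a" by transfer (simp add: algebra_simps commutator_0)
  show "0 + a = a" by transfer (simp add: commutator_0)
  show "- a + a = 0" by transfer (simp add: commutator_0)
  show "a - b = a + - b" by transfer (simp add: commutator_0)
qed

end

lift_definition necklace_scale :: "complex \<Rightarrow> 'd necklace \<Rightarrow> 'd necklace" is pm_scale
  unfolding pm.scale_right_diff_distrib[symmetric] by (rule pm.subspace_scale[OF subspace_commutator])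

lemma tensor_mult_outer: "tensor_mult (outer a t c) = a * tensor_mult t * c"
proof (rule tensor_induct[where f = "\<lambda>t. tensor_mult (outer a t c)" and g = "\<lambda>t. a * tensor_mult t * c"])
  show "pm_linear (\<lambda>t. tensor_mult (outer a t c))"
    by (rule pm_linear_comp[OF linear_tmult linear_outer(1)])
  show "pm_linear (\<lambda>t. a * tensor_mult t * c)"
    by (intro pm_linear_mult_left pm_linear_mult_right linear_tmult)
qed (simp add: outer_tensor tensor_mult mult.assoc)

lemma tensor_mult_flip:
  fixes t :: "'d falg2"
  shows "tensor_mult t - tensor_mult (tensor_flip t) \<in> commutator_space"
proof (rule pm_linear_in_subspace[where f = "\<lambda>t. tensor_mult t - tensor_mult (tensor_flip t)",
      OF _ subspace_commutator])
  show "pm_linear (\<lambda>t. tensor_mult t - tensor_mult (tensor_flip t))"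
    by (intro pm_linear_sub linear_tmult pm_linear_comp[OF linear_tmult] linear_flip)
  fix p :: "('d + 'd) list \<times> ('d + 'd) list"
  obtain u v where "p = (u, v)" by (cases p)
  then show "tensor_mult (basis p) - tensor_mult (tensor_flip (basis p)) \<in> commutator_space"
    using commutator_in[of "basis u" "basis v"] by (simp add: mult_single plus_list_def)
qed

lemma loday_linear: "pm_linear (\<lambda>a. loday_bracket a b)" "pm_linear (loday_bracket a)"
  using double_bracket_symplectic unfolding loday_bracket_def is_symplectic_double_bracket_def
  by (auto intro: pm_linear_comp[OF linear_tmult])

lemma loday_leibniz: "loday_bracket a (b * c) = b * loday_bracket a c + loday_bracket a b * c"
proof -
  have "double_bracket a (b * c) = outer b (double_bracket a c) 1 + outer 1 (double_bracket a b) c"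
    using double_bracket_symplectic unfolding is_symplectic_double_bracket_def by blast
  then show ?thesis by (simp add: loday_bracket_def pm_linear_add[OF linear_tmult] tensor_mult_outer)
qed

lemma loday_antisym: "loday_bracket a b + loday_bracket b a \<in> commutator_space"
proof -
  have "double_bracket a b = - tensor_flip (double_bracket b a)"
    using double_bracket_symplectic unfolding is_symplectic_double_bracket_def by blast
  then have "loday_bracket a b + loday_bracket b a =
      tensor_mult (double_bracket b a) - tensor_mult (tensor_flip (double_bracket b a))"
    by (simp add: loday_bracket_def pm_linear_minus[OF linear_tmult])
  then show ?thesis by (simp add: tensor_mult_flip)
qed

lemma loday_commutator_right:
  assumes "x \<in> commutator_space"
  shows "loday_bracket a x \<in> commutator_space"
proof (rule commutator_induct[OF assms loday_linear(2) subspace_commutator])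
  fix b c
  have "loday_bracket a (b * c - c * b) =
      (b * loday_bracket a c - loday_bracket a c * b) + (loday_bracket a b * c - c * loday_bracket a b)"
    by (simp add: pm_linear_diff[OF loday_linear(2)] loday_leibniz)
  also have "\<dots> \<in> commutator_space"
    by (intro pm.subspace_add[OF subspace_commutator] commutator_in)
  finally show "loday_bracket a (b * c - c * b) \<in> commutator_space" .
qed

lemma loday_commutator_left:
  assumes "x \<in> commutator_space"
  shows "loday_bracket x a \<in> commutator_space"
  using pm.subspace_diff[OF subspace_commutator loday_antisym[of x a] loday_commutator_right[OF assms, of a]]
  by simp

lift_definition necklace_bracket :: "'d necklace \<Rightarrow> 'd necklace \<Rightarrow> 'd necklace" is loday_bracket
proof -
  fix a b c d :: "'d falg"
  assume "a - b \<in> commutator_space" "c - d \<in> commutator_space"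
  then have "loday_bracket (a - b) c + loday_bracket b (c - d) \<in> commutator_space"
    by (intro pm.subspace_add[OF subspace_commutator] loday_commutator_left loday_commutator_right)
  then show "loday_bracket a c - loday_bracket b d \<in> commutator_space"
    by (simp add: pm_linear_diff[OF loday_linear(1)] pm_linear_diff[OF loday_linear(2)])
qed

definition necklace_comp :: "nat \<Rightarrow> 'd necklace set" where
  "necklace_comp k = abs_necklace ` {a. \<forall>w\<in>Poly_Mapping.keys a. length w = k}"

definition necklace_le :: "nat \<Rightarrow> 'd necklace set" where
  "necklace_le k = module.span necklace_scale (\<Union>i\<le>k. necklace_comp i)"


section \<open>The commutative polynomial algebra\<close>

type_synonym 'd cpoly = "(('d + 'd) \<Rightarrow>\<^sub>0 nat) \<Rightarrow>\<^sub>0 complex"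

definition pvar :: "'d + 'd \<Rightarrow> 'd cpoly" where
  "pvar g = basis (Poly_Mapping.single g 1)"

definition cpoly_comp :: "nat \<Rightarrow> 'd cpoly set" where
  "cpoly_comp k = {p. \<forall>m\<in>Poly_Mapping.keys p. (\<Sum>g\<in>Poly_Mapping.keys m. Poly_Mapping.lookup m g) = k}"

definition is_symplectic_poisson :: "('d cpoly \<Rightarrow> 'd cpoly \<Rightarrow> 'd cpoly) \<Rightarrow> bool" where
  "is_symplectic_poisson P \<longleftrightarrow>
     (\<forall>b. pm_linear (\<lambda>a. P a b)) \<and> (\<forall>a. pm_linear (P a)) \<and>
     (\<forall>a b. P a b = - P b a) \<and>
     (\<forall>a b c. P a (P b c) + P b (P c a) + P c (P a b) = 0) \<and>
     (\<forall>a b c. P a (b * c) = b * P a c + P a b * c) \<and>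
     (\<forall>i j. P (pvar (Inl i)) (pvar (Inl j)) = 0) \<and>
     (\<forall>i j. P (pvar (Inr i)) (pvar (Inr j)) = 0) \<and>
     (\<forall>i j. P (pvar (Inl i)) (pvar (Inr j)) = (if i = j then 1 else 0))"

definition poisson_bracket :: "'d cpoly \<Rightarrow> 'd cpoly \<Rightarrow> 'd cpoly" where
  "poisson_bracket = (THE P. is_symplectic_poisson P)"

text \<open>Existence and uniqueness, via partial derivatives.\<close>

definition pdiff :: "'d + 'd \<Rightarrow> 'd cpoly \<Rightarrow> 'd cpoly" where
  "pdiff g = lin_ext (\<lambda>m. pm_scale (of_nat (Poly_Mapping.lookup m g)) (basis (m - Poly_Mapping.single g 1)))"

definition poisson_pdiff :: "'d::finite cpoly \<Rightarrow> 'd cpoly \<Rightarrow> 'd cpoly" where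
  "poisson_pdiff a b =
     (\<Sum>i\<in>UNIV. pdiff (Inl i) a * pdiff (Inr i) b - pdiff (Inr i) a * pdiff (Inl i) b)"

lemma linear_pdiff: "pm_linear (pdiff g)"
  by (simp add: pdiff_def linear_lin_ext)

lemma pdiff_mult: "pdiff g (a * b) = a * pdiff g b + pdiff g a * b"
proof (rule pm_bilinear_eqI[where f = "\<lambda>a b. pdiff g (a * b)"])
  fix m n :: "'a + 'a \<Rightarrow>\<^sub>0 nat"
  let ?s = "Poly_Mapping.single g (1::nat)"
  have shift: "pm_scale (of_nat (Poly_Mapping.lookup n g)) (basis (m + n - ?s)) =
      pm_scale (of_nat (Poly_Mapping.lookup n g)) (basis (m + (n - ?s)))" for m n :: "'a + 'a \<Rightarrow>\<^sub>0 nat"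
  proof (cases "Poly_Mapping.lookup n g = 0")
    case False
    then have "m + n - ?s = m + (n - ?s)"
      by (intro poly_mapping_eqI) (auto simp: lookup_add lookup_minus lookup_single when_def)
    then show ?thesis by simp
  qed simp
  show "pdiff g (basis m * basis n) = basis m * pdiff g (basis n) + pdiff g (basis m) * basis n"
    unfolding mult_single mult_1 pdiff_def lin_ext_basis lookup_add of_nat_add pm.scale_left_distrib
      pm_scale_mult_left pm_scale_mult_right
    using shift[of n m] shift[of m n] by (simp only: add.commute)
qed (intro pm_linear_plus pm_linear_mult_left pm_linear_mult_right pm_linear_comp[OF linear_pdiff]
    linear_pdiff pm_linear_id)+

lemma pdiff_pvar: "pdiff g (pvar h) = (if g = h then 1 else 0)"
  by (auto simp: pdiff_def pvar_def lookup_single)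

lemma poisson_pdiff_linear: "pm_linear (\<lambda>a. poisson_pdiff a b)" "pm_linear (poisson_pdiff a)"
  unfolding poisson_pdiff_def
  by (intro pm_linear_bigsum pm_linear_sub pm_linear_mult_left pm_linear_mult_right linear_pdiff)+

lemma poisson_pdiff_antisym: "poisson_pdiff a b = - poisson_pdiff b a"
  by (simp add: poisson_pdiff_def mult.commute flip: sum_negf)

lemma poisson_pdiff_leibniz: "poisson_pdiff a (b * c) = b * poisson_pdiff a c + poisson_pdiff a b * c"
  unfolding poisson_pdiff_def sum_distrib_left sum_distrib_right sum.distrib[symmetric]
  by (rule sum.cong) (auto simp: pdiff_mult algebra_simps)

lemma poisson_pdiff_pvar: "poisson_pdiff (pvar g) (pvar h) = Poly_Mapping.single 0 (sform g h)"
proof -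
  have d: "(if P then 1 else 0) * (if Q then 1 else 0) = (if P \<and> Q then 1 else (0 :: 'a cpoly))" for P Q
    by simp
  show ?thesis
    by (cases g; cases h) (auto simp: poisson_pdiff_def pdiff_pvar d sum_negf single_uminus
        intro: sum.neutral cong: if_cong)
qed

lemma monomial_induct [case_names one mult]:
  assumes "P 1" "\<And>g p. P p \<Longrightarrow> P (pvar g * p)"
  shows "P (basis m)"
proof (induction "\<Sum>g\<in>Poly_Mapping.keys m. Poly_Mapping.lookup m g" arbitrary: m rule: less_induct)
  case less
  show ?case
  proof (cases "m = 0")
    case True
    then show ?thesis using assms(1) by simp
  next
    case False
    then obtain g where g: "g \<in> Poly_Mapping.keys m"
      by (metis poly_mapping_eqI in_keys_iff lookup_zero)
    define n where "n = m - Poly_Mapping.single g 1"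
    have m: "m = Poly_Mapping.single g 1 + n"
      using g by (intro poly_mapping_eqI) (auto simp: n_def lookup_add lookup_minus lookup_single when_def in_keys_iff)
    have l: "Poly_Mapping.lookup n h = (if h = g then Poly_Mapping.lookup m h - 1 else Poly_Mapping.lookup m h)" for h
      by (simp add: n_def lookup_minus lookup_single when_def)
    have "(\<Sum>h\<in>Poly_Mapping.keys n. Poly_Mapping.lookup n h) = (\<Sum>h\<in>Poly_Mapping.keys m. Poly_Mapping.lookup n h)"
      by (rule sum.mono_neutral_left) (auto simp: in_keys_iff l split: if_splits)
    also have "\<dots> < (\<Sum>h\<in>Poly_Mapping.keys m. Poly_Mapping.lookup m h)"
      by (rule sum_strict_mono_ex1) (use g in \<open>auto simp: l in_keys_iff\<close>)
    finally have "P (pvar g * basis n)" by (intro assms(2) less)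
    then show ?thesis by (simp add: pvar_def mult_single m)
  qed
qed

lemma derivation_eqI:
  fixes f g :: "'d cpoly \<Rightarrow> 'd cpoly"
  assumes "pm_linear f" "pm_linear g" "\<And>a b. f (a * b) = a * f b + f a * b"
    "\<And>a b. g (a * b) = a * g b + g a * b" "\<And>h. f (pvar h) = g (pvar h)"
  shows "f p = g p"
proof (rule pm_linear_eqI[OF assms(1,2)])
  fix m
  have "f 1 = 0" "g 1 = 0" using assms(3)[of 1 1] assms(4)[of 1 1] by simp_all
  then show "f (basis m) = g (basis m)"
    by (induction m rule: monomial_induct) (simp_all add: assms(3-5))
qed

lemma poisson_pdiff_jacobi:
  "poisson_pdiff a (poisson_pdiff b c) + poisson_pdiff b (poisson_pdiff c a) +
   poisson_pdiff c (poisson_pdiff a b) = 0"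
proof -
  define J where "J a b c = poisson_pdiff a (poisson_pdiff b c) + poisson_pdiff b (poisson_pdiff c a) +
   poisson_pdiff c (poisson_pdiff a b)" for a b c :: "'a cpoly"
  have cyc: "J a b c = J b c a" for a b c by (simp add: J_def algebra_simps)
  note add = pm_linear_add[OF poisson_pdiff_linear(2)]
  note neg = pm_linear_minus[OF poisson_pdiff_linear(2)]
  have J': "J a b c = poisson_pdiff a (poisson_pdiff b c) - poisson_pdiff b (poisson_pdiff a c) -
      poisson_pdiff (poisson_pdiff a b) c" for a b c
    unfolding J_def
    by (subst poisson_pdiff_antisym[of c a], subst poisson_pdiff_antisym[of c "poisson_pdiff a b"])
      (simp add: neg)
  have lin: "pm_linear (J a b)" for a b
    unfolding J'
    by (intro pm_linear_sub pm_linear_comp[OF poisson_pdiff_linear(2)] poisson_pdiff_linear(2))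
  have der: "J a b (c * d) = c * J a b d + J a b c * d" for a b c d
    unfolding J' by (simp add: poisson_pdiff_leibniz add algebra_simps)
  have zero: "J a b c = 0" if "\<And>h. J a b (pvar h) = 0" for a b c
    using derivation_eqI[OF lin[of a b] pm_linear_0 der, of c] that by simp
  have const: "poisson_pdiff a (Poly_Mapping.single 0 s) = 0" for a :: "'a cpoly" and s
  proof -
    have 1: "poisson_pdiff a 1 = 0" using poisson_pdiff_leibniz[of a 1 1] by simp
    have "Poly_Mapping.single 0 s = pm_scale s (1 :: 'a cpoly)" by (simp add: pm_scale_conv_mult)
    then show ?thesis by (simp only: pm_linear_scale[OF poisson_pdiff_linear(2)] 1 pm.scale_zero_right)
  qed
  have ggg: "J (pvar f) (pvar g) (pvar h) = 0" for f g h
    by (simp add: J_def poisson_pdiff_pvar const)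
  have gga: "J (pvar f) (pvar g) c = 0" for f g c
    by (rule zero) (rule ggg)
  have gaa: "J (pvar f) b c = 0" for f b c
  proof -
    have "J c (pvar f) (pvar g) = 0" for g
      using gga[of f g c] unfolding cyc[of c] .
    then have "J c (pvar f) b = 0" by (rule zero)
    then show ?thesis unfolding cyc[of c] .
  qed
  have "J a b c = 0"
  proof (rule zero)
    show "J a b (pvar h) = 0" for h
      using gaa[of h a b] unfolding cyc[of "pvar h"] .
  qed
  then show ?thesis by (simp add: J_def)
qed

lemma symplectic_poisson_exists: "is_symplectic_poisson poisson_pdiff"
  unfolding is_symplectic_poisson_def
  by (intro conjI allI poisson_pdiff_linear poisson_pdiff_leibniz poisson_pdiff_jacobi poisson_pdiff_antisym)
    (simp_all add: poisson_pdiff_pvar)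

lemma symplectic_poisson_unique:
  assumes "is_symplectic_poisson P" "is_symplectic_poisson Q"
  shows "P = Q"
proof -
  have gens: "P (pvar g) (pvar h) = Poly_Mapping.single 0 (sform g h)"
    if "is_symplectic_poisson P" for P :: "'a cpoly \<Rightarrow> 'a cpoly \<Rightarrow> 'a cpoly" and g h
  proof -
    have x: "P (pvar (Inl i)) (pvar (Inl j)) = 0" "P (pvar (Inr i)) (pvar (Inr j)) = 0"
      "P (pvar (Inl i)) (pvar (Inr j)) = (if i = j then 1 else 0)" for i j
      using that unfolding is_symplectic_poisson_def by blast+
    have a: "P (pvar g) (pvar h) = - P (pvar h) (pvar g)"
      using that unfolding is_symplectic_poisson_def by blast
    show ?thesis
    proof (cases g; cases h)
      fix i j assume gh: "g = Inr i" "h = Inl j"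
      show ?thesis
        unfolding a unfolding gh x(3) by (auto simp: single_uminus)
    qed (simp_all add: x)
  qed
  have lin: "pm_linear (P a)" "pm_linear (Q a)" for a
    using assms unfolding is_symplectic_poisson_def by - (elim conjE, erule spec)+
  have leib: "R a (b * c) = b * R a c + R a b * c" and anti: "R a b = - R b a"
    if "is_symplectic_poisson R" for R :: "'a cpoly \<Rightarrow> 'a cpoly \<Rightarrow> 'a cpoly" and a b c
  proof -
    note * = that[unfolded is_symplectic_poisson_def]
    show "R a b = - R b a" by (rule *[THEN conjunct2, THEN conjunct2, THEN conjunct1, rule_format])
    show "R a (b * c) = b * R a c + R a b * c"
      by (rule *[THEN conjunct2, THEN conjunct2, THEN conjunct2, THEN conjunct2, THEN conjunct1, rule_format])
  qed
  have ext': "P a b = Q a b" if "\<And>g. P a (pvar g) = Q a (pvar g)" for a b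
    by (rule derivation_eqI[OF lin leib[OF assms(1)] leib[OF assms(2)] that])
  have g: "P (pvar g) b = Q (pvar g) b" for g b
    by (rule ext') (simp add: gens assms)
  have "P a b = Q a b" for a b
  proof (rule ext')
    show "P a (pvar h) = Q a (pvar h)" for h
      using anti[OF assms(1), of a "pvar h"] anti[OF assms(2), of a "pvar h"] g[of h a] by simp
  qed
  then show ?thesis by blast
qed

lemma poisson_bracket_symplectic: "is_symplectic_poisson (poisson_bracket :: 'd::finite cpoly \<Rightarrow> _)"
  unfolding poisson_bracket_def
  by (rule theI[where P = is_symplectic_poisson, OF symplectic_poisson_exists])
    (rule symplectic_poisson_unique[OF _ symplectic_poisson_exists])

lemma poisson_bracket_eq: "poisson_bracket = poisson_pdiff"
  by (rule symplectic_poisson_unique[OF poisson_bracket_symplectic symplectic_poisson_exists])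


section \<open>Abelianisation\<close>

definition abelianise :: "'d falg \<Rightarrow> 'd cpoly" where
  "abelianise = lin_ext (\<lambda>w. \<Prod>g\<leftarrow>w. pvar g)"

lemma linear_abelianise: "pm_linear abelianise"
  by (simp add: abelianise_def linear_lin_ext)

lemma abelianise_basis [simp]: "abelianise (basis w) = (\<Prod>g\<leftarrow>w. pvar g)"
  by (simp add: abelianise_def)

lemma abelianise_mult: "abelianise (a * b) = abelianise a * abelianise b"
  by (rule pm_bilinear_eqI[where f = "\<lambda>a b. abelianise (a * b)"])
    (auto intro!: pm_linear_comp[OF linear_abelianise] linear_abelianise pm_linear_mult_left
      pm_linear_mult_right pm_linear_id simp: mult_single plus_list_def)

lift_definition necklace_abelianise :: "'d necklace \<Rightarrow> 'd cpoly" is abelianise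
proof -
  fix a b :: "'d falg"
  assume "a - b \<in> commutator_space"
  then have "abelianise (a - b) \<in> {0}"
    by (rule commutator_induct[OF _ linear_abelianise pm.subspace_single_0])
      (simp add: pm_linear_diff[OF linear_abelianise] abelianise_mult mult.commute)
  then show "abelianise a = abelianise b" by (simp add: pm_linear_diff[OF linear_abelianise])
qed

lemma necklace_abelianise_word: "necklace_abelianise (abs_necklace (basis w)) = (\<Prod>g\<leftarrow>w. pvar g)"
  by transfer simp

end

(* The necklace bracket is {a,-} acting on cyclic words. Each {a,-} is a derivation of A, hence acts
   on A (x) A, and it turns out to be a derivation of the double bracket as well: the defect is a double
   derivation, antisymmetric under the flip, so it only has to vanish on generators, where it does because
   cutting a cyclic word at two marked letters is symmetric in the marks. Multiplying out gives the Jacobi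
   identity for the Loday bracket. Classes of degree at most 2 are determined by their constant and linear
   coefficients and the symmetrised matrix Q of quadratic coefficients; with Omega the Gram matrix of the
   symplectic form, a quadratic class acts on the linear ones by Q Omega, which ranges over sp. *)

theory Submission
  imports Defs
begin

section \<open>The Jacobi identity\<close>

text \<open>The Loday bracket is antisymmetric only modulo commutators, so on \<open>A\<close>
  itself Jacobi is stated in Leibniz form, \<open>{b,{a,c}} = {{b,a},c} + {a,{b,c}}\<close>, and
  becomes the cyclic identity only in the quotient. The double bracket is antisymmetric exactly, up
  to the flip. This is why the argument runs on the tensor square and is multiplied out only at the
  end: a Leibniz rule in the second slot suffices there, since the flip carries vanishing from one
  slot to the other. A class in the quotient has no coefficients of its own; those of low degree are
  read off through a map on words that is invariant under rotation. One coordinate map serves all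
  three isomorphisms: (a) and (b) are restrictions of (c) to the classes where one of the two
  coordinates vanishes.\<close>

definition tensor_deriv :: "('d falg \<Rightarrow> 'd falg) \<Rightarrow> 'd falg2 \<Rightarrow> 'd falg2" where
  "tensor_deriv D = lin_ext (\<lambda>(u, v). tensor (D (basis u)) (basis v) + tensor (basis u) (D (basis v)))"

lemma linear_tensor_deriv: "pm_linear (tensor_deriv D)"
  by (simp add: tensor_deriv_def linear_lin_ext)

lemma tensor_deriv_tensor:
  assumes "pm_linear D"
  shows "tensor_deriv D (tensor a b) = tensor (D a) b + tensor a (D b)"
proof (rule pm_bilinear_eqI[where f = "\<lambda>a b. tensor_deriv D (tensor a b)"])
  show "tensor_deriv D (tensor (basis u) (basis v)) =
      tensor (D (basis u)) (basis v) + tensor (basis u) (D (basis v))" for u v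
    by (simp add: tensor_deriv_def)
qed (intro pm_linear_plus linear_tensor pm_linear_comp[OF linear_tensor(1)] pm_linear_comp[OF linear_tensor(2)]
    pm_linear_comp[OF linear_tensor_deriv] assms)+

text \<open>Leibniz rule of \<open>D \<otimes> 1 + 1 \<otimes> D\<close> for the outer bimodule
  structure. It is what makes the defect of {b,-} on the double bracket a double derivation.\<close>

lemma tensor_deriv_outer:
  assumes "pm_linear D" "\<And>a b. D (a * b) = a * D b + D a * b"
  shows "tensor_deriv D (outer b t c) = outer (D b) t c + outer b (tensor_deriv D t) c + outer b t (D c)"
proof (rule tensor_induct[where f = "\<lambda>t. tensor_deriv D (outer b t c)"])
  note add = pm_linear_add[OF linear_tensor(1)] pm_linear_add[OF linear_tensor(2)] pm_linear_add[OF linear_outer(1)]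
  show "tensor_deriv D (outer b (tensor u v) c) = outer (D b) (tensor u v) c +
      outer b (tensor_deriv D (tensor u v)) c + outer b (tensor u v) (D c)" for u v
    by (simp add: outer_tensor tensor_deriv_tensor[OF assms(1)] assms(2) add)
qed (intro pm_linear_plus linear_outer pm_linear_comp[OF linear_outer(1)] pm_linear_comp[OF linear_tensor_deriv]
    linear_tensor_deriv)+

lemma tensor_deriv_flip:
  assumes "pm_linear D"
  shows "tensor_deriv D (tensor_flip t) = tensor_flip (tensor_deriv D t)"
  by (rule tensor_induct[where f = "\<lambda>t. tensor_deriv D (tensor_flip t)"])
    (simp_all add: flip_tensor tensor_deriv_tensor[OF assms] pm_linear_add[OF linear_flip] linear_flip
      pm_linear_comp[OF linear_flip] pm_linear_comp[OF linear_tensor_deriv] linear_tensor_deriv)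

text \<open>On a pure tensor this is the Leibniz rule of \<open>D\<close>; it carries an identity on
  the tensor square down to the algebra.\<close>

lemma tensor_mult_tensor_deriv:
  assumes "pm_linear D" "\<And>a b. D (a * b) = a * D b + D a * b"
  shows "tensor_mult (tensor_deriv D t) = D (tensor_mult t)"
  by (rule tensor_induct[where f = "\<lambda>t. tensor_mult (tensor_deriv D t)"])
    (simp_all add: tensor_deriv_tensor[OF assms(1)] tensor_mult pm_linear_add[OF linear_tmult] assms(2)
      pm_linear_comp[OF linear_tmult linear_tensor_deriv] pm_linear_comp[OF assms(1) linear_tmult])

section \<open>The double bracket on words and letters\<close>

lemma double_linear: "pm_linear (\<lambda>a. double_bracket a b)" "pm_linear (double_bracket a)"
  using double_bracket_symplectic unfolding is_symplectic_double_bracket_def by blast+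

lemma double_leibniz: "double_bracket a (b * c) = outer b (double_bracket a c) 1 + outer 1 (double_bracket a b) c"
  using double_bracket_symplectic unfolding is_symplectic_double_bracket_def by blast

lemma double_antisym: "double_bracket a b = - tensor_flip (double_bracket b a)"
  using double_bracket_symplectic unfolding is_symplectic_double_bracket_def by blast

lemma double_basis: "double_bracket (basis u) (basis v) = word_bracket u v"
  by (simp add: double_bracket_eq)

lemma loday_basis: "loday_bracket (basis u) (basis v) = (\<Sum>i<length u. \<Sum>j<length v. pm_scale (sform (u ! i) (v ! j))
     (basis (take j v @ drop (Suc i) u @ take i u @ drop (Suc j) v)))"
  by (simp add: loday_bracket_def double_basis word_bracket_def pm_linear_sum[OF linear_tmult]
      pm_linear_scale[OF linear_tmult])

lemma falg_induct [case_names one gen]: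
  assumes "P 1" "\<And>g p. P p \<Longrightarrow> P (fgen g * p)"
  shows "P (basis w)"
proof (induction w)
  case Nil
  then show ?case using assms(1) by (simp add: one_falg)
next
  case (Cons g w)
  then show ?case using assms(2)[OF Cons, of g] by (simp add: fgen_def mult_single plus_list_def)
qed

lemma double_bracket_gen:
  "double_bracket (basis u) (fgen g) =
     (\<Sum>i<length u. pm_scale (sform (u ! i) g) (basis (drop (Suc i) u, take i u)))"
  by (simp add: fgen_def double_basis word_bracket_def)

text \<open>Bracketing a word with a letter leaves rotations of the form tail @ head. A second cut
  falls on one side of the seam or the other, and the two sums separate these cases.\<close>

lemma double_bracket_gen_append:
  "double_bracket (basis (p @ q)) (fgen g) =
     (\<Sum>i<length p. pm_scale (sform (p ! i) g) (basis (drop (Suc i) p @ q, take i p))) +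
     (\<Sum>i<length q. pm_scale (sform (q ! i) g) (basis (drop (Suc i) q, p @ take i q)))"
  by (simp add: double_bracket_gen sum_lessThan_add nth_append add.commute)

text \<open>The cyclic word \<open>u\<close> with two marked letters is cut into the two arcs between the marks;
  the pair of arcs does not depend on which mark was cut first.\<close>

lemma double_bracket_loday_gen_sym:
  "double_bracket (loday_bracket a (fgen f)) (fgen g) =
     tensor_flip (double_bracket (loday_bracket a (fgen g)) (fgen f))"
proof (rule pm_linear_eqI[where f = "\<lambda>a. double_bracket (loday_bracket a (fgen f)) (fgen g)"
    and g = "\<lambda>a. tensor_flip (double_bracket (loday_bracket a (fgen g)) (fgen f))"])
  fix u :: "('a + 'a) list"
  define n where "n = length u"
  \<comment> \<open>For marks \<open>i < j\<close>, \<open>mid\<close> is the arc strictly between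
    them and \<open>out\<close> the complementary arc, running cyclically from behind
    \<open>j\<close> to before \<open>i\<close>.\<close>
  define mid where "mid i j = take (j - Suc i) (drop (Suc i) u)" for i j
  define out where "out i j = drop (Suc j) u @ take i u" for i j
  define S where "S f g = (\<Sum>i<n. \<Sum>j<n. if i < j then
      pm_scale (sform (u ! i) f * sform (u ! j) g) (basis (out i j, mid i j)) else 0)" for f g
  \<comment> \<open>\<open>S f g\<close> collects the cuts whose mark for \<open>f\<close> precedes
    the mark for \<open>g\<close>. In the opposite order the same arcs arise with the tensor factors
    exchanged, hence the flip of \<open>S g f\<close>. The sum of both is carried to itself by
    flipping and swapping \<open>f\<close> with \<open>g\<close>.\<close>
  have eq: "double_bracket (loday_bracket (basis u) (fgen f)) (fgen g) = S f g + tensor_flip (S g f)" for f g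
  proof -
    \<comment> \<open>The second mark lies behind the first: offset \<open>k\<close> in the tail is
      position \<open>j = Suc i + k\<close> of \<open>u\<close>.\<close>
    have 1: "(\<Sum>k<n - Suc i. pm_scale (sform (drop (Suc i) u ! k) g) (basis (drop (Suc k) (drop (Suc i) u) @ take i u, take k (drop (Suc i) u))))
       = (\<Sum>j<n. if i < j then pm_scale (sform (u ! j) g) (basis (out i j, mid i j)) else 0)" if "i < n" for i
    proof -
      have "(\<Sum>j<n. if i < j then pm_scale (sform (u ! j) g) (basis (out i j, mid i j)) else 0)
         = (\<Sum>j\<in>{Suc i..<n}. pm_scale (sform (u ! j) g) (basis (out i j, mid i j)))"
        by (rule sum.mono_neutral_cong_right) auto
      also have "\<dots> = (\<Sum>k<n - Suc i. pm_scale (sform (u ! (Suc i + k)) g) (basis (out i (Suc i + k), mid i (Suc i + k))))"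
        by (rule sum.reindex_bij_witness[of _ "\<lambda>k. Suc i + k" "\<lambda>j. j - Suc i"]) auto
      also have "\<dots> = (\<Sum>k<n - Suc i. pm_scale (sform (drop (Suc i) u ! k) g) (basis (drop (Suc k) (drop (Suc i) u) @ take i u, take k (drop (Suc i) u))))"
        using that by (intro sum.cong refl) (simp add: out_def mid_def n_def add.commute)
      finally show ?thesis ..
    qed
    \<comment> \<open>The second mark lies before the first, so \<open>k\<close> is already its
      position in \<open>u\<close>.\<close>
    have 2: "(\<Sum>k<i. pm_scale (sform (take i u ! k) g) (basis (drop (Suc k) (take i u), drop (Suc i) u @ take k (take i u))))
       = (\<Sum>j<n. if j < i then pm_scale (sform (u ! j) g) (basis (mid j i, out j i)) else 0)" if "i < n" for i
    proof -
      have "(\<Sum>j<n. if j < i then pm_scale (sform (u ! j) g) (basis (mid j i, out j i)) else 0)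
         = (\<Sum>j<i. pm_scale (sform (u ! j) g) (basis (mid j i, out j i)))"
        using that by (intro sum.mono_neutral_cong_right) auto
      also have "\<dots> = (\<Sum>k<i. pm_scale (sform (take i u ! k) g) (basis (drop (Suc k) (take i u), drop (Suc i) u @ take k (take i u))))"
        by (intro sum.cong refl) (simp add: out_def mid_def drop_take)
      finally show ?thesis ..
    qed
    have "double_bracket (loday_bracket (basis u) (fgen f)) (fgen g) =
        (\<Sum>i<n. pm_scale (sform (u ! i) f) (double_bracket (basis (drop (Suc i) u @ take i u)) (fgen g)))"
      by (simp add: fgen_def loday_basis n_def pm_linear_sum[OF double_linear(1)] pm_linear_scale[OF double_linear(1)])
    also have "\<dots> = (\<Sum>i<n. pm_scale (sform (u ! i) f)
         ((\<Sum>j<n. if i < j then pm_scale (sform (u ! j) g) (basis (out i j, mid i j)) else 0) +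
          (\<Sum>j<n. if j < i then pm_scale (sform (u ! j) g) (basis (mid j i, out j i)) else 0)))"
      unfolding double_bracket_gen_append
    proof (intro sum.cong refl)
      fix i
      assume "i \<in> {..<n}"
      then have "length (drop (Suc i) u) = n - Suc i" "length (take i u) = i" "i < n" by (simp_all add: n_def)
      then show "pm_scale (sform (u ! i) f)
          ((\<Sum>k<length (drop (Suc i) u). pm_scale (sform (drop (Suc i) u ! k) g)
              (basis (drop (Suc k) (drop (Suc i) u) @ take i u, take k (drop (Suc i) u)))) +
           (\<Sum>k<length (take i u). pm_scale (sform (take i u ! k) g)
              (basis (drop (Suc k) (take i u), drop (Suc i) u @ take k (take i u))))) =
        pm_scale (sform (u ! i) f)
         ((\<Sum>j<n. if i < j then pm_scale (sform (u ! j) g) (basis (out i j, mid i j)) else 0) +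
          (\<Sum>j<n. if j < i then pm_scale (sform (u ! j) g) (basis (mid j i, out j i)) else 0))"
        by (simp only: 1 2)
    qed
    also have "\<dots> = S f g + (\<Sum>i<n. \<Sum>j<n. if j < i then
        pm_scale (sform (u ! i) f * sform (u ! j) g) (basis (mid j i, out j i)) else 0)"
      by (simp add: S_def pm.scale_right_distrib pm.scale_sum_right sum.distrib if_distrib cong: if_cong)
    also have "(\<Sum>i<n. \<Sum>j<n. if j < i then
        pm_scale (sform (u ! i) f * sform (u ! j) g) (basis (mid j i, out j i)) else 0) = tensor_flip (S g f)"
      unfolding S_def
      by (subst sum.swap)
        (simp add: pm_linear_sum[OF linear_flip] pm_linear_scale[OF linear_flip] pm_linear_zero[OF linear_flip]
          if_distrib mult.commute cong: if_cong)
    finally show ?thesis .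
  qed
  show "double_bracket (loday_bracket (basis u) (fgen f)) (fgen g) =
      tensor_flip (double_bracket (loday_bracket (basis u) (fgen g)) (fgen f))"
    by (simp add: eq pm_linear_add[OF linear_flip] flip_flip add.commute)
qed (intro pm_linear_comp[OF linear_flip] pm_linear_comp[OF double_linear(1)] loday_linear)+

lemma loday_double_bracket:
  "tensor_deriv (loday_bracket b) (double_bracket a c) =
     double_bracket (loday_bracket b a) c + double_bracket a (loday_bracket b c)"
proof -
  let ?D = "loday_bracket b"
  define E where "E a c = tensor_deriv ?D (double_bracket a c) - double_bracket (?D a) c - double_bracket a (?D c)" for a c
  note D = tensor_deriv_outer[OF loday_linear(2) loday_leibniz, of b]
  have D1: "?D 1 = 0" using loday_leibniz[of b 1 1] by simp
  have outer0: "outer 0 t c = 0" "outer c t 0 = 0" for t c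
    using pm_linear_zero[OF linear_outer(2)] pm_linear_zero[OF linear_outer(3)] by auto
  \<comment> \<open>Cross terms in which \<open>?D\<close> hits the outer factor \<open>c\<close> or
    \<open>e\<close> occur both in \<open>tensor_deriv\<close> of the bracket and in the bracket
    with \<open>?D (c * e)\<close>, and cancel. Those hitting the unit factor vanish by
    \<open>D1\<close>.\<close>
  have leib: "E a (c * e) = outer c (E a e) 1 + outer 1 (E a c) e" for a c e
    unfolding E_def
    by (simp add: double_leibniz loday_leibniz D D1 outer0 pm_linear_add[OF linear_tensor_deriv]
        pm_linear_add[OF double_linear(2)] pm_linear_diff[OF linear_outer(1)])
  have anti: "E a c = - tensor_flip (E c a)" for a c
    unfolding E_def
    by (subst double_antisym[of a c], subst double_antisym[of "?D a" c], subst double_antisym[of a "?D c"])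
      (simp add: pm_linear_minus[OF linear_tensor_deriv] tensor_deriv_flip[OF loday_linear(2)]
        pm_linear_diff[OF linear_flip])
  have lin: "pm_linear (E a)" "pm_linear (\<lambda>a. E a c)" for a c
    unfolding E_def
    by (intro pm_linear_sub pm_linear_comp[OF linear_tensor_deriv] double_linear loday_linear
        pm_linear_comp[OF double_linear(1)] pm_linear_comp[OF double_linear(2)])+
  have one: "E a 1 = 0" for a using leib[of a 1 1] by simp
  have ext: "E a (basis w) = 0" if "\<And>g. E a (fgen g) = 0" for a w
    by (induction w rule: falg_induct)
      (simp_all add: leib one that pm_linear_zero[OF linear_outer(1)])
  \<comment> \<open>The bracket of two letters is a multiple of \<open>tensor 1 1\<close>, which the
    derivation kills; the two remaining terms cancel by the symmetry of double cuts.\<close>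
  have gen: "E (fgen f) (fgen g) = 0" for f g
  proof -
    have "tensor_deriv ?D (double_bracket (fgen f) (fgen g)) = 0"
      by (simp add: fgen_def double_basis word_bracket_def pm_linear_scale[OF linear_tensor_deriv])
        (simp add: tensor_deriv_def D1 pm_linear_zero[OF linear_tensor(1)] pm_linear_zero[OF linear_tensor(2)] flip: one_falg)
    moreover have "double_bracket (fgen f) (?D (fgen g)) = - double_bracket (?D (fgen f)) (fgen g)"
      by (subst double_antisym) (simp add: double_bracket_loday_gen_sym[of b f g])
    ultimately show ?thesis by (simp add: E_def)
  qed
  \<comment> \<open>Extend the second slot from letters to words, exchange the slots by
    antisymmetry, then extend the other slot in the same way.\<close>
  have "E (fgen g) (basis w) = 0" for g w by (rule ext) (rule gen)
  then have "E (basis w) (fgen g) = 0" for g w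
    using anti[of "basis w" "fgen g"] by (simp add: pm_linear_zero[OF linear_flip])
  then have "E (basis u) (basis w) = 0" for u w by (rule ext)
  then have "E a c = 0"
    using pm_bilinear_eqI[where f = E and g = "\<lambda>_ _. 0", OF lin(2) lin(1) pm_linear_0 pm_linear_0] by blast
  then show ?thesis by (simp add: E_def algebra_simps)
qed

lemma loday_jacobi:
  "loday_bracket b (loday_bracket a c) = loday_bracket (loday_bracket b a) c + loday_bracket a (loday_bracket b c)"
  using arg_cong[OF loday_double_bracket[of b a c], of tensor_mult]
  by (simp add: tensor_mult_tensor_deriv[OF loday_linear(2) loday_leibniz] pm_linear_add[OF linear_tmult] loday_bracket_def)


section \<open>The necklace Lie algebra and its graded pieces\<close>

lemma vector_space_necklace: "vector_space necklace_scale"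
proof
  fix a b :: complex and x y :: "'a necklace"
  show "necklace_scale a (x + y) = necklace_scale a x + necklace_scale a y"
    by transfer (simp add: pm.scale_right_distrib commutator_0)
  show "necklace_scale (a + b) x = necklace_scale a x + necklace_scale b x"
    by transfer (simp add: pm.scale_left_distrib commutator_0)
  show "necklace_scale a (necklace_scale b x) = necklace_scale (a * b) x"
    by transfer (simp add: commutator_0)
  show "necklace_scale 1 x = x"
    by transfer (simp add: commutator_0)
qed

interpretation nk: vector_space necklace_scale
  by (rule vector_space_necklace)

text \<open>Invertibility of 2 turns antisymmetry into the alternating law required of a Lie
  bracket.\<close>

lemma vector_space_double_eq_0:
  fixes s :: "complex \<Rightarrow> 'a::ab_group_add \<Rightarrow> 'a" and x :: 'a
  assumes "vector_space s" "x + x = 0"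
  shows "x = 0"
proof -
  interpret vector_space s by fact
  have "s 2 x = x + x" using scale_left_distrib[of 1 1 x] by simp
  then show ?thesis using assms(2) by simp
qed

lemma necklace_bracket_linear:
  "necklace_bracket (x + y) z = necklace_bracket x z + necklace_bracket y z"
  "necklace_bracket z (x + y) = necklace_bracket z x + necklace_bracket z y"
  "necklace_bracket (necklace_scale c x) z = necklace_scale c (necklace_bracket x z)"
  "necklace_bracket z (necklace_scale c x) = necklace_scale c (necklace_bracket z x)"
  by (transfer, simp add: pm_linear_add[OF loday_linear(1)] pm_linear_add[OF loday_linear(2)]
      pm_linear_scale[OF loday_linear(1)] pm_linear_scale[OF loday_linear(2)] commutator_0)+

lemma necklace_bracket_antisym: "necklace_bracket x y = - necklace_bracket y x"
  by transfer (use loday_antisym in simp)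

lemma necklace_bracket_jacobi:
  "necklace_bracket x (necklace_bracket y z) =
     necklace_bracket (necklace_bracket x y) z + necklace_bracket y (necklace_bracket x z)"
  by transfer (simp add: loday_jacobi[symmetric] commutator_0)

lemma lie_algebra_necklace: "lie_algebra necklace_scale UNIV necklace_bracket"
proof unfold_locales
  fix x y z :: "'a necklace"
  show "necklace_bracket x x = 0"
    by (rule vector_space_double_eq_0[OF vector_space_necklace])
      (subst (2) necklace_bracket_antisym, simp)
  \<comment> \<open>Antisymmetry inside the second argument, needed to pass from the Leibniz form of
    Jacobi to the cyclic one.\<close>
  have "necklace_bracket y (necklace_bracket z x + necklace_bracket x z) = 0"
    using necklace_bracket_antisym[of z x] necklace_bracket_linear(2)[of y 0 0] by simp
  then show "necklace_bracket x (necklace_bracket y z) + necklace_bracket y (necklace_bracket z x) +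
      necklace_bracket z (necklace_bracket x y) = 0"
    using necklace_bracket_antisym[of z "necklace_bracket x y"]
    by (simp add: necklace_bracket_jacobi[of x y z] necklace_bracket_linear add_ac)
qed (simp_all add: necklace_bracket_linear)

lemma lie_algebra_subset:
  assumes "lie_algebra s L br" "module.subspace s M" "M \<subseteq> L" "\<And>x y. x \<in> M \<Longrightarrow> y \<in> M \<Longrightarrow> br x y \<in> M"
  shows "lie_algebra s M br"
proof -
  interpret L: lie_algebra s L br by fact
  show ?thesis
    by unfold_locales (use assms(2,3,4) in \<open>auto simp: subset_iff L.br_add_left L.br_add_right
      L.br_scale_left L.br_scale_right L.br_self L.jacobi\<close>)
qed

section \<open>Words as spanning sets, and the degree of the bracket\<close>

definition necklace_word :: "('d + 'd) list \<Rightarrow> 'd necklace" where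
  "necklace_word w = abs_necklace (basis w)"

lemma necklace_word_rotate: "necklace_word (u @ v) = necklace_word (v @ u)"
  using commutator_in[of "basis u" "basis v"]
  by (simp add: necklace_word_def necklace.abs_eq_iff mult_single plus_list_def)

lemma abs_necklace_sum:
  "abs_necklace (\<Sum>i\<in>I. f i) = (\<Sum>i\<in>I. abs_necklace (f i))"
  by (induction I rule: infinite_finite_induct)
    (auto simp: zero_necklace_def plus_necklace.abs_eq[symmetric])

lemma abs_necklace_scale: "abs_necklace (pm_scale c a) = necklace_scale c (abs_necklace a)"
  by (simp add: necklace_scale.abs_eq)

lemma necklace_bracket_word:
  "necklace_bracket (necklace_word u) (necklace_word v) =
     (\<Sum>i<length u. \<Sum>j<length v. necklace_scale (sform (u ! i) (v ! j))
       (necklace_word (take j v @ drop (Suc i) u @ take i u @ drop (Suc j) v)))"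
  by (simp add: necklace_word_def necklace_bracket.abs_eq loday_basis abs_necklace_sum abs_necklace_scale)

text \<open>Turns a condition on the support of representatives into a span of word classes, so that
  statements about graded pieces can be checked on words by linearity.\<close>

lemma abs_necklace_keys:
  "abs_necklace ` {a. \<forall>w\<in>Poly_Mapping.keys a. w \<in> W} = nk.span (necklace_word ` W)"
proof (intro equalityI subsetI)
  fix x
  assume "x \<in> abs_necklace ` {a. \<forall>w\<in>Poly_Mapping.keys a. w \<in> W}"
  then obtain a where x: "x = abs_necklace a" and a: "\<And>w. w \<in> Poly_Mapping.keys a \<Longrightarrow> w \<in> W" by auto
  have "x = (\<Sum>w\<in>Poly_Mapping.keys a. necklace_scale (Poly_Mapping.lookup a w) (necklace_word w))"
    unfolding x necklace_word_def by (subst pm_expand[of a]) (simp only: abs_necklace_sum abs_necklace_scale)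
  also have "\<dots> \<in> nk.span (necklace_word ` W)"
    by (intro nk.span_sum nk.span_scale nk.span_base imageI a)
  finally show "x \<in> nk.span (necklace_word ` W)" .
next
  fix x
  let ?S = "{a :: 'a falg. \<forall>w\<in>Poly_Mapping.keys a. w \<in> W}"
  have "nk.subspace (abs_necklace ` ?S)"
  proof (rule nk.subspaceI)
    show "0 \<in> abs_necklace ` ?S" by (intro image_eqI[of _ _ 0]) (auto simp: zero_necklace_def)
    show "x + y \<in> abs_necklace ` ?S" if xy: "x \<in> abs_necklace ` ?S" "y \<in> abs_necklace ` ?S" for x y
    proof -
      obtain a b where "x = abs_necklace a" "y = abs_necklace b" "a \<in> ?S" "b \<in> ?S" using xy by blast
      then show ?thesis
        using Poly_Mapping.keys_add[of a b]
        by (intro image_eqI[of _ _ "a + b"]) (auto simp: plus_necklace.abs_eq)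
    qed
    show "necklace_scale c x \<in> abs_necklace ` ?S" if x: "x \<in> abs_necklace ` ?S" for x c
    proof -
      obtain a where "x = abs_necklace a" "a \<in> ?S" using x by blast
      then show ?thesis
        by (intro image_eqI[of _ _ "pm_scale c a"]) (auto simp: abs_necklace_scale in_keys_iff)
    qed
  qed
  moreover have "necklace_word ` W \<subseteq> abs_necklace ` ?S"
    by (auto simp: necklace_word_def)
  ultimately have "nk.span (necklace_word ` W) \<subseteq> abs_necklace ` ?S"
    by (intro nk.span_minimal)
  then show "x \<in> nk.span (necklace_word ` W) \<Longrightarrow> x \<in> abs_necklace ` ?S" by blast
qed

lemma necklace_comp_span: "necklace_comp k = nk.span (necklace_word ` {w. length w = k})"
  unfolding necklace_comp_def abs_necklace_keys[symmetric] by simp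

lemma necklace_le_span: "necklace_le k = nk.span (necklace_word ` {w. length w \<le> k})"
  unfolding necklace_le_def
proof (intro equalityI nk.span_minimal nk.subspace_span)
  show "(\<Union>i\<le>k. necklace_comp i) \<subseteq> nk.span (necklace_word ` {w. length w \<le> k})"
    unfolding necklace_comp_span by (intro UN_least nk.span_mono) auto
  show "necklace_word ` {w. length w \<le> k} \<subseteq> nk.span (\<Union>i\<le>k. necklace_comp i)"
    by (auto intro!: nk.span_base simp: necklace_comp_span)
qed

lemma necklace_comp_subset_le: "j \<le> k \<Longrightarrow> necklace_comp j \<subseteq> necklace_le k"
  unfolding necklace_comp_span necklace_le_span by (intro nk.span_mono) auto

lemma necklace_le_mono: "j \<le> k \<Longrightarrow> necklace_le j \<subseteq> necklace_le k"
  unfolding necklace_le_span by (intro nk.span_mono) auto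

lemma necklace_span_induct2:
  assumes "x \<in> nk.span X" "y \<in> nk.span Y"
    and "\<And>y. nk.subspace {x. P x y}" "\<And>x. nk.subspace {y. P x y}"
    and "\<And>x y. x \<in> X \<Longrightarrow> y \<in> Y \<Longrightarrow> P x y"
  shows "P x y"
proof -
  have "P x y" if "x \<in> X" "y \<in> nk.span Y" for x y
    using nk.span_minimal[OF _ assms(4), of Y x] that assms(5) by blast
  then show ?thesis
    using nk.span_minimal[OF _ assms(3), of X y] assms(1,2) by blast
qed

lemma necklace_bracket_span:
  assumes "x \<in> nk.span X" "y \<in> nk.span Y" "nk.subspace S"
    and "\<And>x y. x \<in> X \<Longrightarrow> y \<in> Y \<Longrightarrow> necklace_bracket x y \<in> S"
  shows "necklace_bracket x y \<in> S"
proof (rule necklace_span_induct2[OF assms(1,2)])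
  have z: "necklace_bracket x 0 = 0" "necklace_bracket 0 x = 0" for x :: "'a necklace"
    using necklace_bracket_linear(1)[of 0 0 x] necklace_bracket_linear(2)[of x 0 0] by auto
  show "nk.subspace {x. necklace_bracket x y \<in> S}" "nk.subspace {x. necklace_bracket y x \<in> S}" for y
    using assms(3) by (simp_all add: nk.subspace_def necklace_bracket_linear z)
qed (rule assms(4))

text \<open>Each contraction deletes one letter from each word. The truncated subtraction is
  harmless: if the lengths sum to less than 2, one word is empty and the bracket is 0.\<close>

lemma necklace_bracket_word_in_comp:
  "necklace_bracket (necklace_word u) (necklace_word v) \<in> necklace_comp (length u + length v - 2)"
  unfolding necklace_bracket_word necklace_comp_span
  by (intro nk.span_sum nk.span_scale nk.span_base imageI) auto

lemma necklace_bracket_comp: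
  assumes "x \<in> necklace_comp j" "y \<in> necklace_comp k"
  shows "necklace_bracket x y \<in> necklace_comp (j + k - 2)"
proof (rule necklace_bracket_span[OF assms[unfolded necklace_comp_span]])
  show "nk.subspace (necklace_comp (j + k - 2))" by (simp add: necklace_comp_span)
qed (use necklace_bracket_word_in_comp in force)

text \<open>Closure comes from \<open>2 * k - 2 \<le> k\<close>, that is from
  \<open>k \<le> 2\<close>.\<close>

lemma necklace_bracket_le:
  assumes "x \<in> necklace_le k" "y \<in> necklace_le k" "k \<le> 2"
  shows "necklace_bracket x y \<in> necklace_le k"
proof (rule necklace_bracket_span[OF assms(1,2)[unfolded necklace_le_span]])
  show "nk.subspace (necklace_le k)" by (simp add: necklace_le_span)
  fix x y :: "'a necklace"
  assume "x \<in> necklace_word ` {w. length w \<le> k}" "y \<in> necklace_word ` {w. length w \<le> k}"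
  then obtain u v where uv: "x = necklace_word u" "y = necklace_word v" "length u \<le> k" "length v \<le> k" by auto
  then have "length u + length v - 2 \<le> k" using assms(3) by simp
  then show "necklace_bracket x y \<in> necklace_le k"
    using necklace_bracket_word_in_comp[of u v] necklace_comp_subset_le uv by blast
qed

lemma lie_algebra_necklace_comp_2: "lie_algebra necklace_scale (necklace_comp 2) necklace_bracket"
proof (rule lie_algebra_subset[OF lie_algebra_necklace])
  show "nk.subspace (necklace_comp 2)" by (simp add: necklace_comp_span)
qed (use necklace_bracket_comp[of _ 2 _ 2] in auto)

lemma lie_algebra_necklace_le: "k \<le> 2 \<Longrightarrow> lie_algebra necklace_scale (necklace_le k) necklace_bracket"
proof (rule lie_algebra_subset[OF lie_algebra_necklace])
  show "nk.subspace (necklace_le k)" by (simp add: necklace_le_span)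
qed (use necklace_bracket_le in auto)

lemma lie_subalgebra_necklace_comp_2: "lie_subalgebra necklace_scale UNIV necklace_bracket (necklace_comp 2)"
  using necklace_bracket_comp[of _ 2 _ 2]
  by (auto simp: lie_subalgebra_def lie_algebra_necklace) (simp add: necklace_comp_span)

text \<open>The action is the adjoint one: degrees add to \<open>2 + k - 2 = k\<close>, and the
  module law is Jacobi in Leibniz form.\<close>

lemma lie_module_necklace_comp:
  "lie_module necklace_scale (necklace_comp 2) necklace_bracket necklace_scale (necklace_comp k) necklace_bracket"
  unfolding lie_module_def
proof (intro conjI ballI allI)
  show "nk.subspace (necklace_comp k)" by (simp add: necklace_comp_span)
  fix x y v :: "'a necklace"
  show "necklace_bracket (necklace_bracket x y) v =
      necklace_bracket x (necklace_bracket y v) - necklace_bracket y (necklace_bracket x v)"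
    by (simp add: necklace_bracket_jacobi[of x y v])
  show "necklace_bracket x v \<in> necklace_comp k" if "x \<in> necklace_comp 2" "v \<in> necklace_comp k"
    using necklace_bracket_comp[OF that] by simp
qed (simp_all add: lie_algebra_necklace_comp_2 vector_space_necklace necklace_bracket_linear)


section \<open>Abelianisation is a graded Lie homomorphism\<close>

lemma lie_algebra_poisson:
  "lie_algebra pm_scale UNIV (poisson_bracket :: 'd::finite cpoly \<Rightarrow> _)"
  unfolding poisson_bracket_eq
proof unfold_locales
  fix x :: "'d cpoly"
  show "poisson_pdiff x x = 0"
    by (rule vector_space_double_eq_0[OF vector_space_pm]) (subst (2) poisson_pdiff_antisym, simp)
qed (simp_all add: poisson_pdiff_jacobi pm_linear_add[OF poisson_pdiff_linear(1)] pm_linear_scale[OF poisson_pdiff_linear(1)]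
  pm_linear_add[OF poisson_pdiff_linear(2)] pm_linear_scale[OF poisson_pdiff_linear(2)])

lemma abelianise_commutator:
  assumes "x \<in> commutator_space"
  shows "abelianise x = 0"
proof -
  have "abs_necklace x = 0" using assms by (simp add: zero_necklace_def necklace.abs_eq_iff)
  then have "necklace_abelianise (abs_necklace x) = necklace_abelianise (abs_necklace 0)"
    by (simp add: zero_necklace_def)
  then show ?thesis by (simp add: necklace_abelianise.abs_eq pm_linear_zero[OF linear_abelianise])
qed

lemma abelianise_fgen: "abelianise (fgen g) = pvar g"
  by (simp add: fgen_def)

text \<open>The scheme used for Jacobi applies again. The defect obeys a Leibniz rule over
  \<open>abelianise\<close> in the second slot, is antisymmetric because commutators become 0, and
  vanishes on letters.\<close>

lemma abelianise_loday: "abelianise (loday_bracket a b) = poisson_pdiff (abelianise a) (abelianise b)"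
proof -
  define E where "E a b = abelianise (loday_bracket a b) - poisson_pdiff (abelianise a) (abelianise b)" for a b :: "'a falg"
  have lin: "pm_linear (E a)" "pm_linear (\<lambda>a. E a b)" for a b
    unfolding E_def
    by (intro pm_linear_sub pm_linear_comp[OF linear_abelianise] loday_linear linear_abelianise
      pm_linear_comp[OF poisson_pdiff_linear(1)] pm_linear_comp[OF poisson_pdiff_linear(2)])+
  have leib: "E a (b * c) = abelianise b * E a c + E a b * abelianise c" for a b c
    by (simp add: E_def loday_leibniz abelianise_mult poisson_pdiff_leibniz pm_linear_add[OF linear_abelianise]
      algebra_simps)
  have anti: "E a b = - E b a" for a b
    using abelianise_commutator[OF loday_antisym[of a b]] poisson_pdiff_antisym[of "abelianise a" "abelianise b"]
    by (simp add: E_def pm_linear_add[OF linear_abelianise] add_eq_0_iff algebra_simps)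
  have one: "abelianise 1 = 1" by (simp add: one_falg)
  have E1: "E a 1 = 0" for a using leib[of a 1 1] by (simp add: one)
  have ext: "E a (basis w) = 0" if "\<And>g. E a (fgen g) = 0" for a w
    by (induction w rule: falg_induct) (simp_all add: leib that E1)
  have gen: "E (fgen f) (fgen g) = 0" for f g
  proof -
    have "loday_bracket (fgen f) (fgen g) = pm_scale (sform f g) 1"
      by (simp add: fgen_def loday_basis flip: one_falg)
    moreover have "pm_scale c (1 :: 'a cpoly) = Poly_Mapping.single 0 c" for c
      by (simp add: pm_scale_conv_mult)
    ultimately show ?thesis
      by (simp add: E_def abelianise_fgen poisson_pdiff_pvar pm_linear_scale[OF linear_abelianise] one)
  qed
  have "E (fgen g) (basis w) = 0" for g w by (rule ext) (rule gen)
  then have "E (basis w) (fgen g) = 0" for g w using anti[of "basis w" "fgen g"] by simp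
  then have "E (basis u) (basis w) = 0" for u w by (rule ext)
  then have "E a b = 0"
    using pm_bilinear_eqI[where f = E and g = "\<lambda>_ _. 0", OF lin(2) lin(1) pm_linear_0 pm_linear_0] by blast
  then show ?thesis by (simp add: E_def)
qed

lemma necklace_abelianise_linear:
  "necklace_abelianise (x + y) = necklace_abelianise x + necklace_abelianise y"
  "necklace_abelianise (necklace_scale c x) = pm_scale c (necklace_abelianise x)"
  by (transfer, simp add: pm_linear_add[OF linear_abelianise] pm_linear_scale[OF linear_abelianise])+

lemma lie_hom_abelianise:
  "lie_hom necklace_scale UNIV necklace_bracket pm_scale UNIV poisson_bracket
    (necklace_abelianise :: 'd::finite necklace \<Rightarrow> _)"
  unfolding lie_hom_def
proof (intro conjI ballI allI)
  show "necklace_abelianise (necklace_bracket x y) = poisson_bracket (necklace_abelianise x) (necklace_abelianise y)"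
    for x y :: "'d necklace"
    unfolding poisson_bracket_eq by transfer (rule abelianise_loday)
qed (simp_all add: lie_algebra_necklace lie_algebra_poisson necklace_abelianise_linear)

lemma abelianise_word_in_comp:
  "(\<Prod>g\<leftarrow>w. pvar g) \<in> (cpoly_comp (length w) :: 'd::finite cpoly set)"
proof -
  \<comment> \<open>The exponent vector of the monomial. Since there are finitely many variables,
    its degree can be summed over \<open>UNIV\<close> instead of over the varying support, and is
    then additive.\<close>
  define m where "m w = (\<Sum>g\<leftarrow>w. Poly_Mapping.single g (1::nat))" for w :: "('d + 'd) list"
  have "(\<Prod>g\<leftarrow>w. pvar g) = basis (m w)" for w
    by (induction w) (simp_all add: m_def pvar_def mult_single)
  moreover have "(\<Sum>g\<in>UNIV. Poly_Mapping.lookup (m w) g) = length w" for w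
    by (induction w) (simp_all add: m_def lookup_add sum.distrib lookup_single when_def)
  moreover have "(\<Sum>g\<in>Poly_Mapping.keys n. Poly_Mapping.lookup n g) = (\<Sum>g\<in>UNIV. Poly_Mapping.lookup n g)"
    for n :: "'d + 'd \<Rightarrow>\<^sub>0 nat"
    by (rule sum.mono_neutral_left) (auto simp: in_keys_iff)
  ultimately show ?thesis by (simp add: cpoly_comp_def)
qed

lemma subspace_cpoly_comp: "pm.subspace (cpoly_comp k)"
proof (rule pm.subspaceI)
  show "x + y \<in> cpoly_comp k" if "x \<in> cpoly_comp k" "y \<in> cpoly_comp k" for x y :: "'a cpoly"
    using that Poly_Mapping.keys_add[of x y] by (auto simp: cpoly_comp_def)
qed (auto simp: cpoly_comp_def in_keys_iff)

lemma necklace_abelianise_comp: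
  "necklace_abelianise ` necklace_comp k \<subseteq> (cpoly_comp k :: 'd::finite cpoly set)"
proof -
  have "nk.subspace {x :: 'd necklace. necklace_abelianise x \<in> cpoly_comp k}"
    using subspace_cpoly_comp[where 'a = 'd, of k] necklace_abelianise_linear(1)[of "0 :: 'd necklace" 0]
    by (simp add: nk.subspace_def pm.subspace_def necklace_abelianise_linear)
  moreover have "necklace_word ` {w. length w = k} \<subseteq> {x :: 'd necklace. necklace_abelianise x \<in> cpoly_comp k}"
    using abelianise_word_in_comp by (auto simp: necklace_word_def necklace_abelianise_word)
  ultimately show ?thesis
    unfolding necklace_comp_span using nk.span_minimal by blast
qed


section \<open>Coordinates on the part of degree at most two\<close>

text \<open>At length 2 \<open>rev w\<close> is the other rotation of \<open>w\<close>, so the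
  result is invariant under rotation and descends to the quotient. A square \<open>[g, g]\<close>
  receives coefficient 2.\<close>

definition low_word :: "('d + 'd) list \<Rightarrow> 'd falg" where
  "low_word w = (if length w < 2 then basis w else if length w = 2 then basis w + basis (rev w) else 0)"

lemma low_word_simps [simp]:
  "low_word [] = basis []" "low_word [g] = basis [g]" "low_word [g, h] = basis [g, h] + basis [h, g]"
  by (simp_all add: low_word_def)

lemma low_word_rotate: "low_word (u @ v) = low_word (v @ u)"
proof (cases "u = [] \<or> v = []")
  case False
  then obtain a u' b v' where "u = a # u'" "v = b # v'" by (cases u; cases v) auto
  then show ?thesis by (cases u'; cases v') (auto simp: low_word_def add.commute)
qed auto

lift_definition necklace_low :: "'d necklace \<Rightarrow> 'd falg" is "lin_ext low_word"
proof -
  fix a b :: "'d falg"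
  have comm: "lin_ext low_word (a * b) = lin_ext low_word (b * a)" for a b :: "'d falg"
    by (rule pm_bilinear_eqI[where f = "\<lambda>a b. lin_ext low_word (a * b)"])
      (auto intro!: pm_linear_comp[OF linear_lin_ext] pm_linear_mult_left pm_linear_mult_right pm_linear_id
        simp: mult_single plus_list_def low_word_rotate)
  assume "a - b \<in> commutator_space"
  then have "lin_ext low_word (a - b) \<in> {0}"
    by (rule commutator_induct[OF _ linear_lin_ext pm.subspace_single_0])
      (simp add: pm_linear_diff[OF linear_lin_ext] comm)
  then show "lin_ext low_word a = lin_ext low_word b" by (simp add: pm_linear_diff[OF linear_lin_ext])
qed

lemma necklace_low_word [simp]: "necklace_low (necklace_word w) = low_word w"
  by (simp add: necklace_word_def necklace_low.abs_eq)

lemma necklace_low_linear: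
  "necklace_low (x + y) = necklace_low x + necklace_low y"
  "necklace_low (necklace_scale c x) = pm_scale c (necklace_low x)"
  by (transfer, simp add: pm_linear_add[OF linear_lin_ext] pm_linear_scale[OF linear_lin_ext])+

lemma necklace_low_0 [simp]: "necklace_low 0 = 0"
  using necklace_low_linear(1)[of 0 0] by simp

lemma necklace_low_minus: "necklace_low (- x) = - necklace_low x"
  using necklace_low_linear(1)[of x "- x"] by (simp add: add_eq_0_iff)

lemma necklace_low_sum: "necklace_low (\<Sum>i\<in>I. f i) = (\<Sum>i\<in>I. necklace_low (f i))"
  by (induction I rule: infinite_finite_induct) (auto simp: necklace_low_linear)

text \<open>The Hessian of the quadratic part: \<open>[g, h]\<close> yields the sum of the two
  elementary matrices at (g, h) and (h, g), which doubles the diagonal entries.\<close>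

definition quad_matrix :: "'d::finite necklace \<Rightarrow> complex ^ ('d + 'd) ^ ('d + 'd)" where
  "quad_matrix x = (\<chi> g h. Poly_Mapping.lookup (necklace_low x) [g, h])"

definition heis_coords :: "'d::finite necklace \<Rightarrow> 'd heis" where
  "heis_coords x = ((\<chi> g. Poly_Mapping.lookup (necklace_low x) [g]), Poly_Mapping.lookup (necklace_low x) [])"

definition sp_coords :: "'d::finite necklace \<Rightarrow> complex ^ ('d + 'd) ^ ('d + 'd)" where
  "sp_coords x = quad_matrix x ** sform_matrix"

text \<open>Inverse of the coordinates. As \<open>sform_matrix\<close> squares to minus the
  identity, \<open>M = Q ** sform_matrix\<close> gives \<open>Q = - (M ** sform_matrix)\<close>. The
  factor 1/2 compensates that \<open>[p, q]\<close> and \<open>[q, p]\<close> are the same class,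
  and that squares are doubled in \<open>Q\<close>.\<close>

definition of_coords :: "'d::finite heis \<Rightarrow> complex ^ ('d + 'd) ^ ('d + 'd) \<Rightarrow> 'd necklace" where
  "of_coords h M = necklace_scale (snd h) (necklace_word []) +
     (\<Sum>g\<in>UNIV. necklace_scale (fst h $ g) (necklace_word [g])) +
     (\<Sum>p\<in>UNIV. \<Sum>q\<in>UNIV. necklace_scale (- (M ** sform_matrix) $ p $ q / 2) (necklace_word [p, q]))"

section \<open>Matrix identities and linearity of the coordinates\<close>

lemma sum_UNIV_sum: "(\<Sum>k\<in>UNIV. f k) = (\<Sum>i\<in>UNIV. f (Inl i)) + (\<Sum>i\<in>UNIV. f (Inr i))"
  for f :: "'a::finite + 'b::finite \<Rightarrow> 'c::comm_monoid_add"
  unfolding UNIV_Plus_UNIV[symmetric] by (subst sum.Plus) auto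

lemma if_zero_mult:
  "(if P then x else 0) * y = (if P then x * y else (0 :: complex))"
  "x * (if P then y else 0) = (if P then x * y else (0 :: complex))"
  by simp_all

lemma sform_matrix_square: "sform_matrix ** sform_matrix = - mat 1"
proof -
  have "(\<Sum>k\<in>UNIV. sform p k * sform k q) = - (if p = q then 1 else 0)" for p q :: "'a + 'a"
    by (cases p; cases q) (simp_all add: sum_UNIV_sum if_zero_mult)
  then show ?thesis
    by (simp add: vec_eq_iff matrix_matrix_mult_def sform_matrix_def mat_def)
qed

lemma transpose_minus: "transpose (- A) = - transpose A"
  for A :: "complex ^ 'n ^ 'm"
  by (simp add: vec_eq_iff transpose_def)

lemma transpose_sform_matrix: "transpose sform_matrix = - sform_matrix"
  by (simp add: vec_eq_iff transpose_def sform_matrix_def sform_antisym[symmetric])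

lemma matrix_add_rdistrib: "(A + B) ** C = A ** C + B ** C"
  for A B :: "complex ^ 'n::finite ^ 'm::finite" and C :: "complex ^ 'k::finite ^ 'n"
  by (simp add: vec_eq_iff matrix_matrix_mult_def sum.distrib algebra_simps)

lemma matrix_mul_minus: "(- A) ** B = - (A ** B)" "A ** (- B) = - (A ** B)"
  for A :: "complex ^ 'n::finite ^ 'm::finite" and B :: "complex ^ 'k::finite ^ 'n"
  by (simp_all add: vec_eq_iff matrix_matrix_mult_def sum_negf)

lemma mat_scale_mul: "mat_scale c A ** B = mat_scale c (A ** B)" "A ** mat_scale c B = mat_scale c (A ** B)"
  by (simp_all add: vec_eq_iff matrix_matrix_mult_def mat_scale_def sum_distrib_left mult_ac)

lemma mat_scale_mul_vec: "mat_scale c A *v v = c *s (A *v v)"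
  by (simp add: vec_eq_iff matrix_vector_mult_def mat_scale_def sum_distrib_left mult_ac)

lemma matrix_mul_vec_scale: "A *v (c *s v) = c *s (A *v v)" for A :: "complex ^ 'n::finite ^ 'm::finite"
  by (simp add: vec_eq_iff matrix_vector_mult_def sum_distrib_left mult_ac)

lemma vector_space_heis: "vector_space heis_scale"
  by unfold_locales (auto simp: heis_scale_def prod_scale_def vec_eq_iff algebra_simps)

lemma vector_space_mat: "vector_space (mat_scale :: complex \<Rightarrow> complex ^ 'n ^ 'm \<Rightarrow> _)"
  by unfold_locales (auto simp: mat_scale_def vec_eq_iff algebra_simps)

lemma vector_space_prod:
  assumes "vector_space s" "vector_space t"
  shows "vector_space (prod_scale s t)"
proof -
  interpret s: vector_space s by fact
  interpret t: vector_space t by fact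
  show ?thesis
    by unfold_locales (auto simp: prod_scale_def s.scale_right_distrib s.scale_left_distrib
        t.scale_right_distrib t.scale_left_distrib)
qed

lemma quad_matrix_linear:
  "quad_matrix (x + y) = quad_matrix x + quad_matrix y"
  "quad_matrix (necklace_scale c x) = mat_scale c (quad_matrix x)"
  by (simp_all add: quad_matrix_def vec_eq_iff necklace_low_linear lookup_add mat_scale_def)

lemma heis_coords_linear:
  "heis_coords (x + y) = heis_coords x + heis_coords y"
  "heis_coords (necklace_scale c x) = heis_scale c (heis_coords x)"
  by (simp_all add: heis_coords_def vec_eq_iff necklace_low_linear lookup_add heis_scale_def prod_scale_def)

lemma sp_coords_linear:
  "sp_coords (x + y) = sp_coords x + sp_coords y"
  "sp_coords (necklace_scale c x) = mat_scale c (sp_coords x)"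
  by (simp_all add: sp_coords_def quad_matrix_linear matrix_add_rdistrib mat_scale_mul)

lemma coords_0 [simp]: "quad_matrix 0 = 0" "heis_coords 0 = 0" "sp_coords 0 = 0"
  using quad_matrix_linear(1)[of 0 0] heis_coords_linear(1)[of 0 0] sp_coords_linear(1)[of 0 0] by simp_all

lemma of_coords_linear:
  "of_coords (h + h') (M + M') = of_coords h M + of_coords h' M'"
  "of_coords (heis_scale c h) (mat_scale c M) = necklace_scale c (of_coords h M)"
  by (simp_all add: of_coords_def heis_scale_def prod_scale_def split_beta matrix_add_rdistrib mat_scale_mul
      nk.scale_left_distrib nk.scale_right_distrib sum.distrib nk.scale_sum_right diff_divide_distrib
      nk.scale_left_diff_distrib nk.scale_right_diff_distrib sum_subtractf sum_negf mat_scale_def[of c "M ** sform_matrix"])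

lemma of_coords_0: "of_coords 0 0 = 0"
  using of_coords_linear(1)[of 0 0 0 0] by simp

lemma length_le_2_cases:
  assumes "length w \<le> 2"
  obtains "w = []" | g where "w = [g]" | g h where "w = [g, h]"
proof -
  consider "length w = 0" | "length w = 1" | "length w = 2" using assms by linarith
  then show thesis
    by cases (use that in \<open>auto simp: length_Suc_conv numeral_2_eq_2\<close>)
qed

lemma heis_coords_word [simp]:
  "heis_coords (necklace_word []) = (0, 1)"
  "heis_coords (necklace_word [g]) = (axis g 1, 0)"
  "heis_coords (necklace_word [g, h]) = 0"
  by (auto simp: heis_coords_def vec_eq_iff axis_def lookup_single lookup_add when_def zero_prod_def)

lemma quad_matrix_word:
  "quad_matrix (necklace_word []) = 0"
  "quad_matrix (necklace_word [g]) = 0"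
  "quad_matrix (necklace_word [g, h]) = (\<chi> p q. (if p = g then if q = h then 1 else 0 else 0) +
     (if p = h then if q = g then 1 else 0 else 0))"
  by (auto simp: quad_matrix_def vec_eq_iff lookup_single lookup_add when_def)

lemma sp_coords_word [simp]:
  "sp_coords (necklace_word []) = 0"
  "sp_coords (necklace_word [g]) = 0"
  "sp_coords (necklace_word [g, h]) = (\<chi> p q. (if p = g then sform h q else 0) + (if p = h then sform g q else 0))"
  by (simp_all add: sp_coords_def quad_matrix_word vec_eq_iff matrix_matrix_mult_def sform_matrix_def
      distrib_right sum.distrib if_zero_mult)

lemma necklace_le_2_induct:
  assumes "x \<in> necklace_le 2" "nk.subspace {x. P x}"
    and "P (necklace_word [])" "\<And>g. P (necklace_word [g])" "\<And>g h. P (necklace_word [g, h])"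
  shows "P x"
proof -
  have "necklace_word ` {w. length w \<le> 2} \<subseteq> {x. P x}"
    using assms(3-5) by (auto elim!: length_le_2_cases)
  from nk.span_minimal[OF this assms(2)] show ?thesis
    using assms(1) by (auto simp: necklace_le_span)
qed

lemma heis_coords_comp_2: "x \<in> necklace_comp 2 \<Longrightarrow> heis_coords x = 0"
proof -
  assume x: "x \<in> necklace_comp 2"
  have "nk.subspace {x :: 'a necklace. heis_coords x = 0}"
    by (auto simp: nk.subspace_def heis_coords_linear heis_scale_def prod_scale_def zero_prod_def)
  moreover have "necklace_word ` {w. length w = 2} \<subseteq> {x :: 'a necklace. heis_coords x = 0}"
    by (auto simp: length_Suc_conv numeral_2_eq_2)
  ultimately show ?thesis
    using nk.span_minimal x unfolding necklace_comp_span by blast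
qed

lemma sp_coords_le_1: "x \<in> necklace_le 1 \<Longrightarrow> sp_coords x = 0"
proof -
  assume x: "x \<in> necklace_le 1"
  have "nk.subspace {x :: 'a necklace. sp_coords x = 0}"
    by (auto simp: nk.subspace_def sp_coords_linear mat_scale_def vec_eq_iff)
  moreover have "necklace_word ` {w. length w \<le> 1} \<subseteq> {x :: 'a necklace. sp_coords x = 0}"
    by (auto simp: le_Suc_eq length_Suc_conv)
  ultimately show ?thesis
    using nk.span_minimal x unfolding necklace_le_span by blast
qed

text \<open>With \<open>Q\<close> symmetric and \<Omega> antisymmetric, the transpose of Q\<Omega>
  times \<Omega> is -\<Omega>Q\<Omega>, which cancels \<Omega>(Q\<Omega>).\<close>

lemma sp_coords_in_sp:
  assumes "x \<in> necklace_le 2"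
  shows "sp_coords x \<in> sp"
proof -
  have "transpose (quad_matrix x) = quad_matrix x"
    using assms
    by (rule necklace_le_2_induct)
      (auto simp: nk.subspace_def quad_matrix_linear quad_matrix_word transpose_def mat_scale_def vec_eq_iff)
  then show ?thesis
    by (simp add: sp_def sp_coords_def matrix_transpose_mul transpose_sform_matrix matrix_mul_minus
        matrix_mul_assoc)
qed

lemma sum_scale_delta:
  "(\<Sum>p\<in>UNIV. necklace_scale (if p = g then c else 0) (f p)) = necklace_scale c (f g)"
  for f :: "'a::finite \<Rightarrow> 'b necklace"
  by (subst sum.cong[OF refl, of _ _ "\<lambda>p. if p = g then necklace_scale c (f p) else 0"]) auto

lemma sum_scale_delta2:
  "(\<Sum>p\<in>UNIV. \<Sum>q\<in>UNIV. necklace_scale (if p = g then if q = h then c else 0 else 0) (f p q)) =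
     necklace_scale c (f g h)"
  for f :: "'a::finite \<Rightarrow> 'a \<Rightarrow> 'b necklace"
proof -
  have "(\<Sum>q\<in>UNIV. necklace_scale (if p = g then if q = h then c else 0 else 0) (f p q)) =
      (if p = g then necklace_scale c (f p h) else 0)" for p
    by (simp add: sum_scale_delta)
  then show ?thesis by simp
qed

lemma sum_mult_delta:
  "(\<Sum>k\<in>UNIV. f k * (if k = g then 1 else 0)) = f g"
  "(\<Sum>p\<in>UNIV. \<Sum>q\<in>UNIV. F p q * (if p = a \<and> q = b then 1 else 0)) = F a b"
  "(\<Sum>p\<in>UNIV. \<Sum>q\<in>UNIV. F p q * (if q = b \<and> p = a then 1 else 0)) = F a b"
  for f :: "'a::finite \<Rightarrow> complex" and F :: "'a \<Rightarrow> 'a \<Rightarrow> complex"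
proof -
  have 1: "(\<Sum>k\<in>UNIV. f k * (if k = g then 1 else 0)) = f g" for f :: "'a \<Rightarrow> complex" and g
    by (subst sum.cong[OF refl, of _ _ "\<lambda>p. if p = g then f p else 0"]) auto
  show "(\<Sum>k\<in>UNIV. f k * (if k = g then 1 else 0)) = f g" by (rule 1)
  have "(\<Sum>q\<in>UNIV. F p q * (if p = a \<and> q = b then 1 else 0)) = (if p = a then F p b else 0)" for p
    using 1[of "F p" b] by (cases "p = a") auto
  then show "(\<Sum>p\<in>UNIV. \<Sum>q\<in>UNIV. F p q * (if p = a \<and> q = b then 1 else 0)) = F a b" by simp
  then show "(\<Sum>p\<in>UNIV. \<Sum>q\<in>UNIV. F p q * (if q = b \<and> p = a then 1 else 0)) = F a b"
    by (simp only: conj_commute)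
qed

lemma of_coords_sp_coords:
  assumes "x \<in> necklace_le 2"
  shows "of_coords (heis_coords x) (sp_coords x) = x"
  using assms
proof (rule necklace_le_2_induct)
  \<comment> \<open>Recovers \<open>Q\<close> from Q\<Omega> by a further multiplication with
    \<Omega>, whose square is -1.\<close>
  have q: "- (sp_coords x ** sform_matrix) = quad_matrix x" for x :: "'a necklace"
    by (simp add: sp_coords_def sform_matrix_square matrix_mul_minus flip: matrix_mul_assoc)
  have of_coords: "of_coords (heis_coords x) (sp_coords x) = necklace_scale (snd (heis_coords x)) (necklace_word []) +
     (\<Sum>g\<in>UNIV. necklace_scale (fst (heis_coords x) $ g) (necklace_word [g])) +
     (\<Sum>p\<in>UNIV. \<Sum>q\<in>UNIV. necklace_scale (quad_matrix x $ p $ q / 2) (necklace_word [p, q]))" for x :: "'a necklace"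
    unfolding of_coords_def q[symmetric] by simp
  show "nk.subspace {x :: 'a necklace. of_coords (heis_coords x) (sp_coords x) = x}"
    by (auto simp: nk.subspace_def of_coords_0 of_coords_linear heis_coords_linear sp_coords_linear)
  show "of_coords (heis_coords (necklace_word [])) (sp_coords (necklace_word [])) = (necklace_word [] :: 'a necklace)"
    unfolding of_coords by (simp add: quad_matrix_word)
  show "of_coords (heis_coords (necklace_word [g])) (sp_coords (necklace_word [g])) = (necklace_word [g] :: 'a necklace)" for g
    unfolding of_coords by (simp add: quad_matrix_word axis_def sum_scale_delta)
  show "of_coords (heis_coords (necklace_word [g, h])) (sp_coords (necklace_word [g, h])) = (necklace_word [g, h] :: 'a necklace)" for g h
  proof -
    \<comment> \<open>The quadratic sum returns half of \<open>[g, h]\<close> plus half of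
      \<open>[h, g]\<close>, equal classes by rotation. Keeping the two summands apart also covers
      \<open>g = h\<close>.\<close>
    have half: "quad_matrix (necklace_word [g, h]) $ p $ q / 2 = (if p = g then if q = h then 1 / 2 else 0 else 0) +
        (if p = h then if q = g then 1 / 2 else 0 else 0)" for p q
      by (simp add: quad_matrix_word)
    have "of_coords (heis_coords (necklace_word [g, h])) (sp_coords (necklace_word [g, h])) =
        necklace_scale (1/2) (necklace_word [g, h]) + necklace_scale (1/2) (necklace_word [h, g] :: 'a necklace)"
      unfolding of_coords half nk.scale_left_distrib sum.distrib sum_scale_delta2 by simp
    also have "necklace_word [h, g] = (necklace_word [g, h] :: 'a necklace)"
      using necklace_word_rotate[of "[h]" "[g]"] by simp
    finally show ?thesis by (simp flip: nk.scale_left_distrib)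
  qed
qed

lemma coords_of_coords:
  assumes "M \<in> sp"
  shows "heis_coords (of_coords h M) = h" "sp_coords (of_coords h M) = M"
proof -
  define N where "N = - (M ** sform_matrix)"
  \<comment> \<open>Multiplying the equation of \<open>sp\<close> by \<Omega> on both sides and
    using that its square is -1 leaves the symmetry of \<open>N\<close>, the intended quadratic
    matrix.\<close>
  have "sform_matrix ** (transpose M ** sform_matrix + sform_matrix ** M) ** sform_matrix = 0"
    using assms by (simp add: sp_def)
  moreover have "sform_matrix ** (transpose M ** sform_matrix + sform_matrix ** M) ** sform_matrix =
      sform_matrix ** transpose M ** (sform_matrix ** sform_matrix) + (sform_matrix ** sform_matrix) ** M ** sform_matrix"
    by (simp add: matrix_add_ldistrib matrix_add_rdistrib matrix_mul_assoc)
  ultimately have "sform_matrix ** transpose M + M ** sform_matrix = 0"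
    unfolding sform_matrix_square matrix_mul_minus by (simp add: neg_eq_iff_add_eq_0 add.commute)
  then have "sform_matrix ** transpose M = - (M ** sform_matrix)"
    by (simp add: eq_neg_iff_add_eq_0)
  then have sym: "transpose N = N"
    by (simp add: N_def transpose_minus transpose_sform_matrix matrix_mul_minus matrix_transpose_mul)
  have low: "necklace_low (of_coords h M) = pm_scale (snd h) (basis []) + (\<Sum>g\<in>UNIV. pm_scale (fst h $ g) (basis [g])) +
     (\<Sum>p\<in>UNIV. \<Sum>q\<in>UNIV. pm_scale (N $ p $ q / 2) (basis [p, q] + basis [q, p]))"
    by (simp add: of_coords_def necklace_low_linear necklace_low_minus necklace_low_sum N_def)
  show "heis_coords (of_coords h M) = h"
    unfolding heis_coords_def low
    by (cases h) (simp add: lookup_add lookup_sum lookup_single when_def vec_eq_iff sum_mult_delta)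
  \<comment> \<open>Passing through word classes symmetrises \<open>N\<close>, so symmetry is what
    returns it unchanged.\<close>
  have "quad_matrix (of_coords h M) $ p $ q = N $ p $ q / 2 + N $ q $ p / 2" for p q
    unfolding quad_matrix_def low
    by (simp add: lookup_add lookup_sum lookup_single when_def distrib_left sum.distrib
        sum_mult_delta flip: sum_divide_distrib)
  then have "quad_matrix (of_coords h M) = N"
    using arg_cong[OF sym, of "\<lambda>A. A $ _ $ _"] by (simp add: vec_eq_iff transpose_def)
  then show "sp_coords (of_coords h M) = M"
    by (simp add: sp_coords_def N_def matrix_mul_minus sform_matrix_square flip: matrix_mul_assoc)
qed

lemma of_coords_le_2: "of_coords h M \<in> necklace_le 2"
  unfolding of_coords_def necklace_le_span
  by (intro nk.span_add nk.span_sum nk.span_scale nk.span_base imageI) auto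

lemma of_coords_le_1: "of_coords h 0 \<in> necklace_le 1"
proof -
  have "of_coords h 0 = necklace_scale (snd h) (necklace_word []) +
     (\<Sum>g\<in>UNIV. necklace_scale (fst h $ g) (necklace_word [g]))"
    by (simp add: of_coords_def matrix_matrix_mult_def)
  also have "\<dots> \<in> necklace_le 1"
    unfolding necklace_le_span
    by (intro nk.span_add nk.span_sum nk.span_scale nk.span_base imageI) auto
  finally show ?thesis .
qed

lemma of_coords_comp_2: "of_coords 0 M \<in> necklace_comp 2"
proof -
  have "of_coords 0 M = (\<Sum>p\<in>UNIV. \<Sum>q\<in>UNIV. necklace_scale (- (M ** sform_matrix) $ p $ q / 2) (necklace_word [p, q]))"
    by (simp add: of_coords_def)
  also have "\<dots> \<in> necklace_comp 2"
    unfolding necklace_comp_span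
    by (intro nk.span_sum nk.span_scale nk.span_base imageI) auto
  finally show ?thesis .
qed


section \<open>The isomorphisms\<close>

abbreviation heis_sp_bracket ::
  "'d::finite heis \<times> (complex ^ ('d + 'd) ^ ('d + 'd)) \<Rightarrow> 'd heis \<times> (complex ^ ('d + 'd) ^ ('d + 'd)) \<Rightarrow>
   'd heis \<times> (complex ^ ('d + 'd) ^ ('d + 'd))" where
  "heis_sp_bracket \<equiv> semidirect_bracket heis_bracket mat_bracket heis_act"

lemma sform_self: "sform a a = 0"
  by (cases a) simp_all

lemma heis_sp_bracket_eq:
  "heis_sp_bracket ((v, s), M) ((w, t), N) =
     ((M *v w - N *v v, \<Sum>i\<in>UNIV. v $ Inl i * w $ Inr i - v $ Inr i * w $ Inl i), M ** N - N ** M)"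
  by (simp add: semidirect_bracket_def heis_bracket_def heis_act_def mat_bracket_def)

lemma heis_sp_bracket_antisym: "heis_sp_bracket x y = - heis_sp_bracket y x"
proof -
  obtain v s M w t N where "x = ((v, s), M)" "y = ((w, t), N)" by (metis surj_pair)
  then show ?thesis by (simp add: heis_sp_bracket_eq mult.commute flip: sum_negf)
qed

lemma heis_sp_bracket_linear_left:
  "heis_sp_bracket (x + x') y = heis_sp_bracket x y + heis_sp_bracket x' y"
  "heis_sp_bracket (prod_scale heis_scale mat_scale c x) y =
     prod_scale heis_scale mat_scale c (heis_sp_bracket x y)"
proof -
  obtain v s M v' s' M' w t N where eq: "x = ((v, s), M)" "x' = ((v', s'), M')" "y = ((w, t), N)"
    by (metis surj_pair)
  show "heis_sp_bracket (x + x') y = heis_sp_bracket x y + heis_sp_bracket x' y"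
    by (simp add: eq heis_sp_bracket_eq matrix_vector_mult_add_rdistrib matrix_vector_right_distrib
        matrix_add_ldistrib matrix_add_rdistrib algebra_simps sum.distrib sum_subtractf)
  show "heis_sp_bracket (prod_scale heis_scale mat_scale c x) y =
      prod_scale heis_scale mat_scale c (heis_sp_bracket x y)"
    by (simp add: eq heis_sp_bracket_eq prod_scale_def heis_scale_def mat_scale_mul mat_scale_mul_vec
        matrix_mul_vec_scale mat_scale_def[of c "_ - _"] sum_distrib_left right_diff_distrib vec_eq_iff mult_ac)
      (simp add: mat_scale_def right_diff_distrib)
qed

lemma heis_sp_bracket_linear_right:
  "heis_sp_bracket y (x + x') = heis_sp_bracket y x + heis_sp_bracket y x'"
  "heis_sp_bracket y (prod_scale heis_scale mat_scale c x) =
     prod_scale heis_scale mat_scale c (heis_sp_bracket y x)"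
proof -
  interpret P: vector_space "prod_scale heis_scale mat_scale ::
      complex \<Rightarrow> 'a heis \<times> (complex ^ ('a + 'a) ^ ('a + 'a)) \<Rightarrow> _"
    by (intro vector_space_prod vector_space_heis vector_space_mat)
  show "heis_sp_bracket y (x + x') = heis_sp_bracket y x + heis_sp_bracket y x'"
    using heis_sp_bracket_antisym[of y "x + x'"] heis_sp_bracket_antisym[of y x] heis_sp_bracket_antisym[of y x']
    by (simp add: heis_sp_bracket_linear_left)
  show "heis_sp_bracket y (prod_scale heis_scale mat_scale c x) =
      prod_scale heis_scale mat_scale c (heis_sp_bracket y x)"
    using heis_sp_bracket_antisym[of y "prod_scale heis_scale mat_scale c x"] heis_sp_bracket_antisym[of y x]
    by (simp add: heis_sp_bracket_linear_left)
qed

definition coords :: "'d::finite necklace \<Rightarrow> 'd heis \<times> (complex ^ ('d + 'd) ^ ('d + 'd))" where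
  "coords x = (heis_coords x, sp_coords x)"

lemma coords_linear:
  "coords (x + y) = coords x + coords y"
  "coords (necklace_scale c x) = prod_scale heis_scale mat_scale c (coords x)"
  by (simp_all add: coords_def heis_coords_linear sp_coords_linear prod_scale_def)

lemma coords_zero: "coords 0 = 0"
  using coords_linear(1)[of 0 0] by simp

lemma coords_bracket_word:
  assumes "length u \<le> 2" "length v \<le> 2"
  shows "coords (necklace_bracket (necklace_word u) (necklace_word v)) =
     heis_sp_bracket (coords (necklace_word u)) (coords (necklace_word v))"
proof -
  define hom where "hom x y \<longleftrightarrow> coords (necklace_bracket x y) = heis_sp_bracket (coords x) (coords y)"
    for x y :: "'a necklace"
  \<comment> \<open>Both brackets are antisymmetric, so only the first word being no shorter than
    the second, or empty, has to be treated.\<close>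
  have hom_sym: "hom x y" if "hom y x" for x y
  proof -
    have "coords (necklace_bracket x y) + coords (necklace_bracket y x) = 0"
      using necklace_bracket_antisym[of x y] by (simp add: coords_zero flip: coords_linear)
    then show ?thesis
      using that heis_sp_bracket_antisym[of "coords x" "coords y"] unfolding hom_def
      by (simp add: add_eq_0_iff)
  qed
  \<comment> \<open>The empty word has nothing to contract; its image spans the centre of the
    Heisenberg algebra, on which matrices act by 0.\<close>
  have const: "hom (necklace_word []) (necklace_word w)" for w
  proof -
    obtain h t M where "coords (necklace_word w) = ((h, t), M)" by (metis surj_pair)
    then show ?thesis
      by (simp add: hom_def necklace_bracket_word coords_zero)
        (simp add: coords_def heis_sp_bracket_eq zero_prod_def matrix_matrix_mult_def matrix_vector_mult_def vec_eq_iff)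
  qed
  have lin_lin: "hom (necklace_word [g]) (necklace_word [h])" for g h
  proof -
    \<comment> \<open>On basis vectors the Heisenberg cocycle is \<open>sform\<close>, the
      coefficient of the contracted empty word.\<close>
    have "(\<Sum>i\<in>UNIV. axis g 1 $ Inl i * axis h 1 $ Inr i - axis g 1 $ Inr i * axis h 1 $ Inl i) = sform g h"
      by (cases g; cases h) (simp_all add: axis_def sum_subtractf if_zero_mult sum_negf)
    then show ?thesis
      by (simp add: hom_def necklace_bracket_word coords_linear)
        (simp add: coords_def heis_sp_bracket_eq prod_scale_def heis_scale_def zero_prod_def
          mat_scale_def vec_eq_iff matrix_matrix_mult_def matrix_vector_mult_def)
  qed
  have quad_lin: "hom (necklace_word [g, h]) (necklace_word [k])" for g h k
  proof -
    \<comment> \<open>This is the contraction of the letter \<open>k\<close> with the word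
      \<open>[g, h]\<close>: column \<open>k\<close> of the matrix is the bracket with that letter,
      which is why the matrix acts by the defining representation.\<close>
    have "sp_coords (necklace_word [g, h]) *v axis k 1 = sform h k *s axis g 1 + sform g k *s axis h 1"
      by (auto simp: vec_eq_iff matrix_vector_mult_def axis_def sum_mult_delta)
    then show ?thesis
      by (simp add: hom_def necklace_bracket_word coords_linear lessThan_Suc del: sp_coords_word)
        (simp add: coords_def heis_sp_bracket_eq prod_scale_def heis_scale_def zero_prod_def
          mat_scale_def vec_eq_iff matrix_matrix_mult_def matrix_vector_mult_def)
  qed
  have quad_quad: "hom (necklace_word [g, h]) (necklace_word [k, l])" for g h k l
  proof -
    have mult: "sp_coords (necklace_word [g, h]) ** sp_coords (necklace_word [k, l]) = (\<chi> p q.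
        (if p = g then sform h k * sform l q + sform h l * sform k q else 0) +
        (if p = h then sform g k * sform l q + sform g l * sform k q else 0))" for g h k l :: "'a + 'a"
      by (simp add: vec_eq_iff matrix_matrix_mult_def distrib_left distrib_right sum.distrib if_zero_mult)
    have "sp_coords (necklace_bracket (necklace_word [g, h]) (necklace_word [k, l])) =
        sp_coords (necklace_word [g, h]) ** sp_coords (necklace_word [k, l]) -
        sp_coords (necklace_word [k, l]) ** sp_coords (necklace_word [g, h])"
      unfolding mult
      \<comment> \<open>Both sides expand into products of two \<open>sform\<close> values;
        orienting the arguments by antisymmetry makes the terms of the four contractions
        match.\<close>
      by (simp add: necklace_bracket_word lessThan_Suc sp_coords_linear vec_eq_iff mat_scale_def
          sform_antisym[of l g] sform_antisym[of l h] sform_antisym[of k g] sform_antisym[of k h]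
          sform_antisym[of l k] sform_antisym[of h g] sform_self algebra_simps)
    moreover have "heis_coords (necklace_bracket (necklace_word [g, h]) (necklace_word [k, l])) = 0"
      by (simp add: necklace_bracket_word lessThan_Suc heis_coords_linear heis_scale_def prod_scale_def zero_prod_def)
    ultimately show ?thesis
      by (simp add: hom_def coords_def zero_prod_def heis_sp_bracket_eq)
  qed
  have "hom (necklace_word u) (necklace_word v)"
    using assms
    by (elim length_le_2_cases) (auto intro: const lin_lin quad_lin quad_quad hom_sym)
  then show ?thesis by (simp add: hom_def)
qed

lemma coords_bracket:
  assumes "x \<in> necklace_le 2" "y \<in> necklace_le 2"
  shows "coords (necklace_bracket x y) = heis_sp_bracket (coords x) (coords y)"
proof (rule necklace_span_induct2[OF assms[unfolded necklace_le_span]])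
  let ?P = "\<lambda>x y :: 'a necklace. coords (necklace_bracket x y) = heis_sp_bracket (coords x) (coords y)"
  have z: "necklace_bracket x 0 = 0" "necklace_bracket 0 x = 0" for x :: "'a necklace"
    using necklace_bracket_linear(1)[of 0 0 x] necklace_bracket_linear(2)[of x 0 0] by auto
  have z': "heis_sp_bracket x 0 = 0" "heis_sp_bracket 0 x = 0" for x :: "'a heis \<times> _"
    using heis_sp_bracket_linear_left(1)[of 0 0 x] heis_sp_bracket_linear_right(1)[of x 0 0] by auto
  show "nk.subspace {x. ?P x y}" "nk.subspace {y. ?P x y}" for x y
    by (simp_all add: nk.subspace_def necklace_bracket_linear coords_linear coords_zero z z'
        heis_sp_bracket_linear_left heis_sp_bracket_linear_right)
qed (auto intro: coords_bracket_word)

text \<open>Transport of structure: the Lie axioms on the target follow from those of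
  \<open>L\<close> through the bijection. Thus the Heisenberg, symplectic and semidirect brackets
  need no separate verification.\<close>

lemma lie_isomorphicI:
  assumes "lie_algebra s L br" "vector_space t" "bij_betw f L M"
    and add: "\<And>x y. x \<in> L \<Longrightarrow> y \<in> L \<Longrightarrow> f (x + y) = f x + f y"
    and scale: "\<And>c x. x \<in> L \<Longrightarrow> f (s c x) = t c (f x)"
    and br: "\<And>x y. x \<in> L \<Longrightarrow> y \<in> L \<Longrightarrow> f (br x y) = br' (f x) (f y)"
  shows "lie_isomorphic s L br t M br'"
proof -
  interpret L: lie_algebra s L br by fact
  interpret t: vector_space t by fact
  have M: "M = f ` L" using assms(3) by (simp add: bij_betw_def)
  note closed = L.subspace_add[OF L.subspace_carrier] L.subspace_scale[OF L.subspace_carrier]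
    L.subspace_0[OF L.subspace_carrier] L.br_closed
  have f0: "f 0 = 0" using add[of 0 0] closed by simp
  have "lie_algebra t M br'"
  proof unfold_locales
    show "t.subspace M"
      unfolding M t.subspace_def
      by (auto simp: closed simp flip: f0 add scale)
    fix y assume "y \<in> M"
    then obtain x where x: "x \<in> L" "y = f x" unfolding M by blast
    show "br' y y = 0" using br[OF x(1) x(1)] by (simp add: x f0 L.br_self)
    fix y' assume "y' \<in> M"
    then obtain x' where x': "x' \<in> L" "y' = f x'" unfolding M by blast
    show "br' y y' \<in> M" unfolding M x x' by (simp add: x x' closed flip: br)
    show "br' (t c y) y' = t c (br' y y')" "br' y (t c y') = t c (br' y y')" for c
      by (simp_all add: x x' closed L.br_scale_left L.br_scale_right flip: br scale)
    fix y'' assume "y'' \<in> M"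
    then obtain x'' where x'': "x'' \<in> L" "y'' = f x''" unfolding M by blast
    show "br' (y + y') y'' = br' y y'' + br' y' y''" "br' y (y' + y'') = br' y y' + br' y y''"
      by (simp_all add: x x' x'' closed L.br_add_left L.br_add_right flip: br add)
    show "br' y (br' y' y'') + br' y' (br' y'' y) + br' y'' (br' y y') = 0"
      by (simp add: x x' x'' closed L.jacobi f0 flip: br add)
  qed
  then show ?thesis
    unfolding lie_isomorphic_def lie_hom_def
    using assms M by blast
qed

lemma necklace_le_2_isomorphic:
  "lie_isomorphic necklace_scale (necklace_le 2 :: 'd::finite necklace set) necklace_bracket
     (prod_scale heis_scale mat_scale)
     ((UNIV :: 'd heis set) \<times> (sp :: (complex ^ ('d + 'd) ^ ('d + 'd)) set)) heis_sp_bracket"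
proof (rule lie_isomorphicI[where f = coords])
  show "bij_betw coords (necklace_le 2 :: 'd necklace set)
      ((UNIV :: 'd heis set) \<times> (sp :: (complex ^ ('d + 'd) ^ ('d + 'd)) set))"
    by (rule bij_betw_byWitness[where f' = "\<lambda>(h, M). of_coords h M"])
      (auto simp: coords_def of_coords_sp_coords coords_of_coords sp_coords_in_sp of_coords_le_2)
qed (simp_all add: lie_algebra_necklace_le vector_space_prod vector_space_heis vector_space_mat
    coords_linear coords_bracket)

text \<open>In degree at most 1 the matrix coordinate is 0, so the semidirect bracket reduces to the
  Heisenberg one and \<open>of_coords h 0\<close> inverts the map.\<close>

lemma necklace_le_1_isomorphic:
  "lie_isomorphic necklace_scale (necklace_le 1 :: 'd::finite necklace set) necklace_bracket
     heis_scale (UNIV :: 'd heis set) heis_bracket"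
proof (rule lie_isomorphicI[where f = heis_coords])
  have le: "x \<in> necklace_le 2" if "x \<in> necklace_le 1" for x :: "'d necklace"
    using that necklace_le_mono[of 1 2] by auto
  have zero: "(0 :: complex ^ ('d + 'd) ^ ('d + 'd)) \<in> sp"
    by (simp add: sp_def vec_eq_iff matrix_matrix_mult_def transpose_def)
  have of_coords: "of_coords (heis_coords x) 0 = x" if "x \<in> necklace_le 1" for x :: "'d necklace"
    using of_coords_sp_coords[OF le[OF that]] sp_coords_le_1[OF that] by simp
  show "bij_betw heis_coords (necklace_le 1 :: 'd necklace set) UNIV"
    by (rule bij_betw_byWitness[where f' = "\<lambda>h. of_coords h 0"])
      (use of_coords_le_1 in \<open>auto simp: of_coords coords_of_coords[OF zero]\<close>)
  show "heis_coords (necklace_bracket x y) = heis_bracket (heis_coords x) (heis_coords y)"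
    if "x \<in> necklace_le 1" "y \<in> necklace_le 1" for x y :: "'d necklace"
    using coords_bracket[OF le[OF that(1)] le[OF that(2)]] sp_coords_le_1[OF that(1)] sp_coords_le_1[OF that(2)]
    by (simp add: coords_def semidirect_bracket_def heis_act_def split_beta flip: zero_prod_def)
qed (simp_all add: lie_algebra_necklace_le vector_space_heis heis_coords_linear)

text \<open>In degree 2 the Heisenberg coordinate is 0, so the matrix component of the general
  bracket formula and of the inverse suffices.\<close>

lemma necklace_comp_2_isomorphic:
  "lie_isomorphic necklace_scale (necklace_comp 2 :: 'd::finite necklace set) necklace_bracket
     mat_scale (sp :: (complex ^ ('d + 'd) ^ ('d + 'd)) set) mat_bracket"
proof (rule lie_isomorphicI[where f = sp_coords])
  have le: "x \<in> necklace_le 2" if "x \<in> necklace_comp 2" for x :: "'d necklace"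
    using that necklace_comp_subset_le[of 2 2] by auto
  have of_coords: "of_coords 0 (sp_coords x) = x" if "x \<in> necklace_comp 2" for x :: "'d necklace"
    using of_coords_sp_coords[OF le[OF that]] heis_coords_comp_2[OF that] by simp
  show "bij_betw sp_coords (necklace_comp 2 :: 'd necklace set) sp"
    by (rule bij_betw_byWitness[where f' = "\<lambda>M. of_coords 0 M"])
      (use of_coords_comp_2 in \<open>auto simp: of_coords coords_of_coords sp_coords_in_sp le\<close>)
  show "sp_coords (necklace_bracket x y) = mat_bracket (sp_coords x) (sp_coords y)"
    if "x \<in> necklace_comp 2" "y \<in> necklace_comp 2" for x y :: "'d necklace"
    using coords_bracket[OF le[OF that(1)] le[OF that(2)]]
    by (simp add: coords_def semidirect_bracket_def)
qed (simp_all add: lie_algebra_necklace_comp_2 vector_space_mat sp_coords_linear)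


theorem theorem3:
  shows "(lie_subalgebra necklace_scale UNIV necklace_bracket
            (necklace_comp 2 :: 'd::finite necklace set) \<and>
          (\<forall>k. lie_module necklace_scale (necklace_comp 2 :: 'd necklace set) necklace_bracket
            necklace_scale (necklace_comp k) necklace_bracket)) \<and>
         (lie_hom necklace_scale UNIV necklace_bracket pm_scale UNIV poisson_bracket
            (necklace_abelianise :: 'd necklace \<Rightarrow> 'd cpoly) \<and>
          (\<forall>k. (necklace_abelianise :: 'd necklace \<Rightarrow> 'd cpoly) ` necklace_comp k \<subseteq> cpoly_comp k)) \<and>
         lie_isomorphic necklace_scale (necklace_le 1 :: 'd necklace set) necklace_bracket
           heis_scale (UNIV :: 'd heis set) heis_bracket \<and>
         lie_isomorphic necklace_scale (necklace_comp 2 :: 'd necklace set) necklace_bracket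
           mat_scale (sp :: (complex ^ ('d + 'd) ^ ('d + 'd)) set) mat_bracket \<and>
         lie_isomorphic necklace_scale (necklace_le 2 :: 'd necklace set) necklace_bracket
           (prod_scale heis_scale mat_scale)
           ((UNIV :: 'd heis set) \<times> (sp :: (complex ^ ('d + 'd) ^ ('d + 'd)) set))
           (semidirect_bracket heis_bracket mat_bracket heis_act)"
  by (intro conjI allI lie_subalgebra_necklace_comp_2 lie_module_necklace_comp lie_hom_abelianise
      necklace_abelianise_comp necklace_le_1_isomorphic necklace_comp_2_isomorphic necklace_le_2_isomorphic)

end
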